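(* Let $G$ be a finite abelian group with a structure of a metric group and let $E\colon G\to\mathbb{C}$ be a finite quantum dilogarithm on $G$. Then $E(u)\in\overline{\mathbb{Q}}$ for all $u\in G$.
   Context: A metric group is a finite abelian group $G$ together with a function $\langle\cdot\rangle\colon G\to\mathbb{C}^\times$ such that $\langle x\rangle=\langle -x\rangle$ for all $x$ and $\langle x;y\rangle:=\dfrac{\langle x+y\rangle}{\langle x\rangle\langle y\rangle}$ is a non-degenerate bicharacter on $G$. Let $N=|G|$. A finite quantum dilogarithm for a metric group $G$ is a function $E\colon G\to\mathbb{C}$ such that for some non-zero constant $C\in\mathbb{C}^\times$ and all $x,y\in G$, $$\langle x;y\rangle E(x)E(y)=C+\frac1{\sqrt N}\sum_{z\in G}E(y-z)E(z)\langle z\rangle E(x-z),$$ and which, when $|G|\le4$, is in addition required to satisfy $E(0)^2=\sqrt{N}\,E(0)+1$ (for $|G|>4$ this relation is automatic). *)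

theory Defs
  imports Complex_Main "HOL-Computational_Algebra.Computational_Algebra"
begin

text \<open>
  The finite abelian group is a type of class \<open>finite\<close> and \<open>ab_group_add\<close>,
  and its order is \<open>card (UNIV :: 'a set)\<close>.
\<close>

definition bicharacter :: "('a::ab_group_add \<Rightarrow> 'a \<Rightarrow> complex) \<Rightarrow> bool" where
  "bicharacter b \<longleftrightarrow>
     (\<forall>x y. b x y \<noteq> 0) \<and>
     (\<forall>x x' y. b (x + x') y = b x y * b x' y) \<and>
     (\<forall>x y y'. b x (y + y') = b x y * b x y')"

text \<open>
  The maps \<open>x \<mapsto> b x _\<close> and \<open>y \<mapsto> b _ y\<close> into the character group
  are injective; for a finite group they are then isomorphisms.
\<close>

definition nondegenerate :: "('a::ab_group_add \<Rightarrow> 'a \<Rightarrow> complex) \<Rightarrow> bool" where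
  "nondegenerate b \<longleftrightarrow>
     (\<forall>x. (\<forall>y. b x y = 1) \<longrightarrow> x = 0) \<and>
     (\<forall>y. (\<forall>x. b x y = 1) \<longrightarrow> y = 0)"

definition polar :: "('a::ab_group_add \<Rightarrow> complex) \<Rightarrow> 'a \<Rightarrow> 'a \<Rightarrow> complex" where
  "polar q x y = q (x + y) / (q x * q y)"

definition metric_group :: "('a::{finite,ab_group_add} \<Rightarrow> complex) \<Rightarrow> bool" where
  "metric_group q \<longleftrightarrow>
     (\<forall>x. q x \<noteq> 0) \<and> (\<forall>x. q x = q (- x)) \<and>
     bicharacter (polar q) \<and> nondegenerate (polar q)"

definition finite_quantum_dilogarithm ::
  "('a::{finite,ab_group_add} \<Rightarrow> complex) \<Rightarrow> ('a \<Rightarrow> complex) \<Rightarrow> bool" where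
  "finite_quantum_dilogarithm q E \<longleftrightarrow>
     (let N = card (UNIV :: 'a set); rN = complex_of_real (sqrt (real N)) in
       (\<exists>C. C \<noteq> 0 \<and>
         (\<forall>x y. polar q x y * E x * E y =
            C + 1 / rN * (\<Sum>z\<in>UNIV. E (y - z) * E z * q z * E (x - z)))) \<and>
       (N \<le> 4 \<longrightarrow> (E 0)\<^sup>2 = rN * E 0 + 1))"

end

theory Submission
  imports Defs
begin

text \<open>
  If \<open>E u\<close> were transcendental, some derivation \<open>D\<close> of the complex numbers would not kill \<open>E u\<close>.
  But the solutions are infinitesimally rigid: with \<open>s = sqrt N\<close>, the Fourier transform of the
  pentagon relation gives \<open>E x * E (- x) * q x = 1\<close> for \<open>x \<noteq> 0\<close>, \<open>(E 0)\<^sup>2 = s * E 0 + 1\<close> and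
  \<open>FT E x = \<gamma> * q x * E (- x)\<close> for a constant \<open>\<gamma>\<close>, apart from exceptional solutions constant off
  \<open>0\<close>, which exist only for \<open>N \<le> 4\<close>. Hence \<open>D\<close> kills \<open>E 0\<close>, \<open>\<gamma>\<close> and \<open>q\<close>, and \<open>\<phi> = D E / E\<close> is odd
  and solves the linearised pentagon relation. Summing that relation against the convolution
  inverse of \<open>E\<close> in one variable and against \<open>q x * E x\<close> in the other (a partial trace, as in
  the proof of Ocneanu rigidity) yields \<open>(2 * E 0 - s) * \<phi> = 0\<close>, while \<open>(2 * E 0 - s)\<^sup>2 = N + 4\<close>.
\<close>

section \<open>Derivations\<close>

definition derivation :: "('a::field_char_0 \<Rightarrow> 'a) \<Rightarrow> bool" where
  "derivation D \<longleftrightarrow>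
     (\<forall>x y. D (x + y) = D x + D y) \<and> (\<forall>x y. D (x * y) = D x * y + x * D y)"

lemma derivationD:
  assumes D: "derivation D"
  shows derivation_add: "D (x + y) = D x + D y"
    and derivation_mult: "D (x * y) = D x * y + x * D y"
    and derivation_0: "D 0 = 0"
    and derivation_1: "D 1 = 0"
    and derivation_minus: "D (- x) = - D x"
    and derivation_of_nat: "D (of_nat n) = 0"
    and derivation_sum: "D (sum f I) = (\<Sum>i\<in>I. D (f i))"
proof -
  have add: "D (x + y) = D x + D y" and mult: "D (x * y) = D x * y + x * D y" for x y
    using D by (auto simp: derivation_def)
  have zero: "D 0 = 0" using add[of 0 0] by simp
  have one: "D 1 = 0" using mult[of 1 1] by simp
  show "D (x + y) = D x + D y" "D (x * y) = D x * y + x * D y" "D 0 = 0" "D 1 = 0"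
    by (fact add mult zero one)+
  show "D (- x) = - D x"
    using add[of x "- x"] zero by (simp add: eq_neg_iff_add_eq_0 add.commute)
  show "D (of_nat n) = 0"
    by (induction n) (simp_all add: add zero one)
  show "D (sum f I) = (\<Sum>i\<in>I. D (f i))"
    by (induction I rule: infinite_finite_induct) (simp_all add: add zero)
qed

lemma derivation_const_divide:
  assumes D: "derivation D" and "D c = 0"
  shows "D (x / c) = D x / c"
proof (cases "c = 0")
  case False
  then have "D x = D (x / c) * c" using derivation_mult[OF D, of "x / c" c] assms by simp
  then show ?thesis using False by simp
qed (simp add: derivation_0[OF D])

text \<open>
  A partial derivation is handled through its graph, which is a subfield of the dual numbers
  \<open>x + \<epsilon> a\<close>; Zorn's lemma then applies to these graphs under inclusion.
\<close>

definition dual_subring :: "('a::field_char_0 \<times> 'a) set \<Rightarrow> bool" where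
  "dual_subring R \<longleftrightarrow> (1, 0) \<in> R \<and>
     (\<forall>x a y b. (x, a) \<in> R \<longrightarrow> (y, b) \<in> R \<longrightarrow>
        (x - y, a - b) \<in> R \<and> (x * y, a * y + x * b) \<in> R)"

definition derivation_graph :: "('a::field_char_0 \<times> 'a) set \<Rightarrow> bool" where
  "derivation_graph R \<longleftrightarrow> dual_subring R \<and>
     (\<forall>x a. (x, a) \<in> R \<longrightarrow> x \<noteq> 0 \<longrightarrow> (1 / x, - a / x\<^sup>2) \<in> R) \<and>
     (\<forall>a. (0, a) \<in> R \<longrightarrow> a = 0)"

lemma dual_subringD:
  assumes "dual_subring R"
  shows dual_one: "(1, 0) \<in> R"
    and dual_diff: "\<And>x a y b. (x, a) \<in> R \<Longrightarrow> (y, b) \<in> R \<Longrightarrow> (x - y, a - b) \<in> R"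
    and dual_mult: "\<And>x a y b. (x, a) \<in> R \<Longrightarrow> (y, b) \<in> R \<Longrightarrow> (x * y, a * y + x * b) \<in> R"
    and dual_zero: "(0, 0) \<in> R"
    and dual_add: "\<And>x a y b. (x, a) \<in> R \<Longrightarrow> (y, b) \<in> R \<Longrightarrow> (x + y, a + b) \<in> R"
proof -
  show one: "(1, 0) \<in> R"
    and diff: "\<And>x a y b. (x, a) \<in> R \<Longrightarrow> (y, b) \<in> R \<Longrightarrow> (x - y, a - b) \<in> R"
    and "\<And>x a y b. (x, a) \<in> R \<Longrightarrow> (y, b) \<in> R \<Longrightarrow> (x * y, a * y + x * b) \<in> R"
    using assms by (auto simp: dual_subring_def)
  show zero: "(0, 0) \<in> R" using diff[OF one one] by simp
  show "(x + y, a + b) \<in> R" if "(x, a) \<in> R" "(y, b) \<in> R" for x a y b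
    using diff[OF that(1) diff[OF zero that(2)]] by simp
qed

lemma derivation_graphD:
  assumes "derivation_graph R"
  shows derivation_graph_dual_subring: "dual_subring R"
    and derivation_graph_zero: "\<And>a. (0, a) \<in> R \<Longrightarrow> a = 0"
    and derivation_graph_inverse: "\<And>x a. (x, a) \<in> R \<Longrightarrow> x \<noteq> 0 \<Longrightarrow> (1 / x, - a / x\<^sup>2) \<in> R"
  using assms unfolding derivation_graph_def by blast+

lemma dual_sum:
  assumes "dual_subring R" "\<And>i. i \<in> I \<Longrightarrow> (f i, g i) \<in> R"
  shows "(sum f I, sum g I) \<in> R"
proof (cases "finite I")
  case True
  then show ?thesis using assms(2)
    by (induction I rule: finite_induct) (auto intro: dual_zero dual_add assms(1))
qed (simp add: dual_zero[OF assms(1)])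

text \<open>The quotient rule extends a derivation to the fraction field. A quotient equal to 0 has
  numerator 0, so uniqueness of the value at 0 is inherited from \<open>R\<close>.\<close>

lemma derivation_graph_fractions:
  fixes R :: "('a::field_char_0 \<times> 'a) set"
  assumes R: "dual_subring R" and sv: "\<And>a. (0, a) \<in> R \<Longrightarrow> a = 0"
  shows "\<exists>R'. R \<subseteq> R' \<and> derivation_graph R'"
proof -
  define R' where "R' = {(x / y, (a * y - x * b) / y\<^sup>2) | x a y b.
    (x, a) \<in> R \<and> (y, b) \<in> R \<and> y \<noteq> 0}"
  have R'I: "(X, A) \<in> R'"
    if "(x, a) \<in> R" "(y, b) \<in> R" "y \<noteq> 0" "X = x / y" "A = (a * y - x * b) / y\<^sup>2" for X A x a y b
    using that unfolding R'_def by blast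
  note ops = dual_subringD[OF R]
  have "(x / y - x' / y', (a * y - x * b) / y\<^sup>2 - (a' * y' - x' * b') / y'\<^sup>2) \<in> R' \<and>
        (x / y * (x' / y'), (a * y - x * b) / y\<^sup>2 * (x' / y') + x / y * ((a' * y' - x' * b') / y'\<^sup>2)) \<in> R'"
    if "(x, a) \<in> R" "(y, b) \<in> R" "y \<noteq> 0" "(x', a') \<in> R" "(y', b') \<in> R" "y' \<noteq> 0"
    for x a y b x' a' y' b'
  proof
    show "(x / y - x' / y', (a * y - x * b) / y\<^sup>2 - (a' * y' - x' * b') / y'\<^sup>2) \<in> R'"
      by (rule R'I[OF ops(2)[OF ops(3)[OF that(1,5)] ops(3)[OF that(4,2)]] ops(3)[OF that(2,5)]])
        (use that in \<open>simp_all add: field_simps power2_eq_square\<close>)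
    show "(x / y * (x' / y'), (a * y - x * b) / y\<^sup>2 * (x' / y') + x / y * ((a' * y' - x' * b') / y'\<^sup>2)) \<in> R'"
      by (rule R'I[OF ops(3)[OF that(1,4)] ops(3)[OF that(2,5)]])
        (use that in \<open>simp_all add: field_simps power2_eq_square\<close>)
  qed
  moreover have "(1, 0) \<in> R'"
    by (rule R'I[OF ops(1) ops(1)]) auto
  ultimately have "dual_subring R'"
    unfolding dual_subring_def by (auto simp: R'_def)
  moreover have "(1 / X, - A / X\<^sup>2) \<in> R'" if XA: "(X, A) \<in> R'" "X \<noteq> 0" for X A
  proof -
    obtain x a y b where *: "(x, a) \<in> R" "(y, b) \<in> R" "y \<noteq> 0" "X = x / y" "A = (a * y - x * b) / y\<^sup>2"
      using XA unfolding R'_def by blast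
    then have "x \<noteq> 0" using XA(2) by auto
    with *(3) show ?thesis unfolding *(4,5)
      by (intro R'I[OF *(2,1)]) (simp_all add: field_simps power2_eq_square)
  qed
  moreover have "A = 0" if A: "(0, A) \<in> R'" for A
  proof -
    obtain x a y b where *: "(x, a) \<in> R" "(y, b) \<in> R" "y \<noteq> 0" "0 = x / y" "A = (a * y - x * b) / y\<^sup>2"
      using A unfolding R'_def by blast
    then have "x = 0" by simp
    then show ?thesis using * sv by auto
  qed
  moreover have "R \<subseteq> R'"
    by (auto intro: R'I[OF _ ops(1)])
  ultimately show ?thesis
    unfolding derivation_graph_def by blast
qed

section \<open>Extension of a derivation by one element\<close>

definition dual_poly :: "('a::field_char_0 \<times> 'a) set \<Rightarrow> ('a poly \<times> 'a poly) set" where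
  "dual_poly R = {(p, p'). \<forall>i. (coeff p i, coeff p' i) \<in> R}"

text \<open>The \<open>\<epsilon>\<close>-part of \<open>p + \<epsilon> p'\<close> evaluated at \<open>s + \<epsilon> c\<close>.\<close>

definition dual_eval :: "'a::field_char_0 \<Rightarrow> 'a \<Rightarrow> 'a poly \<Rightarrow> 'a poly \<Rightarrow> 'a" where
  "dual_eval s c p p' = poly p' s + c * poly (pderiv p) s"

lemma dual_poly_diff:
  assumes "dual_subring R" "(p, p') \<in> dual_poly R" "(r, r') \<in> dual_poly R"
  shows "(p - r, p' - r') \<in> dual_poly R"
  using assms by (auto simp: dual_poly_def intro: dual_diff)

lemma dual_poly_mult:
  assumes "dual_subring R" "(p, p') \<in> dual_poly R" "(r, r') \<in> dual_poly R"
  shows "(p * r, p' * r + p * r') \<in> dual_poly R"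
  using assms
  by (auto simp: dual_poly_def coeff_mult sum.distrib[symmetric] intro!: dual_sum dual_mult)

lemma dual_poly_monom:
  assumes "dual_subring R" "(x, a) \<in> R"
  shows "(monom x n, monom a n) \<in> dual_poly R"
  using assms by (auto simp: dual_poly_def dual_zero)

lemma dual_eval_diff: "dual_eval s c (p - r) (p' - r') = dual_eval s c p p' - dual_eval s c r r'"
  by (simp add: dual_eval_def pderiv_diff algebra_simps)

lemma dual_eval_mult:
  "dual_eval s c (p * r) (p' * r + p * r') = dual_eval s c p p' * poly r s + poly p s * dual_eval s c r r'"
  by (simp add: dual_eval_def pderiv_mult algebra_simps)

text \<open>The value \<open>c\<close> at \<open>s\<close> may be prescribed once it respects every
  polynomial relation of \<open>s\<close> over the domain of \<open>R\<close>: the values at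
  \<open>s + \<epsilon> c\<close> of polynomials over \<open>R\<close> then form a dual subring, and
  fractions complete it to a graph.\<close>

lemma derivation_graph_adjoin:
  assumes R: "derivation_graph R"
    and sv: "\<And>p p'. (p, p') \<in> dual_poly R \<Longrightarrow> poly p s = 0 \<Longrightarrow> dual_eval s c p p' = 0"
  shows "\<exists>R'. R \<subseteq> R' \<and> (s, c) \<in> R' \<and> derivation_graph R'"
proof -
  have R1: "dual_subring R" using R by (rule derivation_graph_dual_subring)
  define S where "S = {(poly p s, dual_eval s c p p') | p p'. (p, p') \<in> dual_poly R}"
  have SI: "(X, A) \<in> S" if "(p, p') \<in> dual_poly R" "X = poly p s" "A = dual_eval s c p p'" for X A p p'
    using that by (auto simp: S_def)
  have const: "(x, a) \<in> S" if "(x, a) \<in> R" for x a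
    by (rule SI[OF dual_poly_monom[OF R1 that, of 0]])
      (simp_all add: dual_eval_def poly_monom monom_0)
  have "(x - y, a - b) \<in> S \<and> (x * y, a * y + x * b) \<in> S" if xy: "(x, a) \<in> S" "(y, b) \<in> S" for x a y b
  proof -
    obtain p p' where p: "(p, p') \<in> dual_poly R" "x = poly p s" "a = dual_eval s c p p'"
      using xy by (auto simp: S_def)
    obtain r r' where r: "(r, r') \<in> dual_poly R" "y = poly r s" "b = dual_eval s c r r'"
      using xy by (auto simp: S_def)
    show ?thesis
    proof
      show "(x - y, a - b) \<in> S"
        by (rule SI[OF dual_poly_diff[OF R1 p(1) r(1)]]) (use p r in \<open>simp_all add: dual_eval_diff\<close>)
      show "(x * y, a * y + x * b) \<in> S"
        by (rule SI[OF dual_poly_mult[OF R1 p(1) r(1)]]) (use p r in \<open>simp_all add: dual_eval_mult\<close>)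
    qed
  qed
  then have S: "dual_subring S"
    using const[OF dual_one[OF R1]] unfolding dual_subring_def by blast
  have "a = 0" if "(0, a) \<in> S" for a
    using that sv by (auto simp: S_def)
  then obtain R' where R': "S \<subseteq> R'" "derivation_graph R'"
    using derivation_graph_fractions[OF S] by blast
  have "(s, c) \<in> S"
    by (rule SI[OF dual_poly_monom[OF R1 dual_one[OF R1], of 1]])
      (simp_all add: dual_eval_def poly_monom pderiv_monom)
  then show ?thesis using R' const by (metis subrelI subset_iff)
qed

lemma dual_poly_zero:
  assumes "derivation_graph R" "(0, p') \<in> dual_poly R"
  shows "p' = 0"
  using assms derivation_graph_zero[OF assms(1)] by (auto simp: dual_poly_def poly_eq_iff)

text \<open>There is no nontrivial relation to respect, so \<open>c\<close> is arbitrary.\<close>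

lemma derivation_graph_adjoin_transcendental:
  assumes R: "derivation_graph R"
    and tr: "\<And>p. \<forall>i. coeff p i \<in> Domain R \<Longrightarrow> poly p s = 0 \<Longrightarrow> p = 0"
  shows "\<exists>R'. R \<subseteq> R' \<and> (s, c) \<in> R' \<and> derivation_graph R'"
proof (rule derivation_graph_adjoin[OF R])
  fix p p' assume p: "(p, p') \<in> dual_poly R" "poly p s = 0"
  then have "p = 0" using tr by (auto simp: dual_poly_def)
  moreover have "p' = 0" using dual_poly_zero[OF R] p \<open>p = 0\<close> by simp
  ultimately show "dual_eval s c p p' = 0" by (simp add: dual_eval_def)
qed

text \<open>Here \<open>c\<close> is forced: differentiating a relation \<open>m\<close> of least
  degree determines it, since \<open>pderiv m\<close> does not vanish at \<open>s\<close> in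
  characteristic 0. Division by \<open>m\<close> carries the compatibility from \<open>m\<close> to
  all relations.\<close>

lemma derivation_graph_adjoin_algebraic:
  assumes R: "derivation_graph R"
    and alg: "\<exists>p. (\<forall>i. coeff p i \<in> Domain R) \<and> poly p s = 0 \<and> p \<noteq> 0"
  shows "\<exists>c R'. R \<subseteq> R' \<and> (s, c) \<in> R' \<and> derivation_graph R'"
proof -
  have R1: "dual_subring R" using R by (rule derivation_graph_dual_subring)
  define P where "P = (\<lambda>p. p \<noteq> 0 \<and> poly p s = 0 \<and> (\<exists>p'. (p, p') \<in> dual_poly R))"
  have "\<exists>p. P p"
  proof -
    obtain p where p: "\<forall>i. coeff p i \<in> Domain R" "poly p s = 0" "p \<noteq> 0" using alg by blast
    then have "\<forall>i. \<exists>a. (coeff p i, a) \<in> R" by blast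
    then obtain f where f: "\<And>i. (coeff p i, f i) \<in> R" by metis
    have "(p, \<Sum>i\<le>degree p. monom (f i) i) \<in> dual_poly R"
      using f dual_zero[OF R1] by (auto simp: dual_poly_def coeff_sum coeff_eq_0)
    then show ?thesis using p by (auto simp: P_def)
  qed
  then obtain m where m: "P m" and min: "\<And>p. P p \<Longrightarrow> degree m \<le> degree p"
    using ex_has_least_nat[of P _ degree] by blast
  obtain m' where m': "(m, m') \<in> dual_poly R" using m by (auto simp: P_def)
  have m0: "m \<noteq> 0" "poly m s = 0" using m by (auto simp: P_def)
  have deg: "degree m > 0"
  proof (rule ccontr)
    assume "\<not> degree m > 0"
    then obtain a where "m = [:a:]" by (metis degree_eq_zeroE not_gr_zero)
    then show False using m0 by simp
  qed
  \<comment> \<open>A zero here would make \<open>pderiv m\<close> a nonzero relation of smaller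
    degree; the pairs \<open>(of_nat n, 0)\<close> keep its coefficients in the domain of
    \<open>R\<close>.\<close>
  have pm': "poly (pderiv m) s \<noteq> 0"
  proof
    assume z: "poly (pderiv m) s = 0"
    have cn: "(of_nat n, 0) \<in> R" for n
      by (induction n) (use dual_add[OF R1 dual_one[OF R1]] dual_zero[OF R1] in auto)
    have "(pderiv m, pderiv m') \<in> dual_poly R"
      using m' dual_mult[OF R1 cn] by (auto simp: dual_poly_def coeff_pderiv simp del: of_nat_Suc)
    moreover have "pderiv m \<noteq> 0" using deg by (simp add: pderiv_eq_0_iff)
    ultimately have "degree m \<le> degree (pderiv m)" using z by (intro min) (auto simp: P_def)
    then show False using deg by (simp add: degree_pderiv)
  qed
  define c where "c = - poly m' s / poly (pderiv m) s"
  have em: "dual_eval s c m m' = 0" using pm' by (simp add: dual_eval_def c_def)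
  obtain a where a: "(lead_coeff m, a) \<in> R" using m' by (auto simp: dual_poly_def)
  have inv: "(1 / lead_coeff m, - a / (lead_coeff m)\<^sup>2) \<in> R"
    using derivation_graph_inverse[OF R a] m0 by simp
  have "dual_eval s c p p' = 0" if "(p, p') \<in> dual_poly R" "poly p s = 0" for p p'
    using that
  proof (induction "degree p" arbitrary: p p' rule: less_induct)
    case less
    show ?case
    proof (cases "p = 0")
      case True
      then have "p' = 0" using dual_poly_zero[OF R] less.prems by simp
      then show ?thesis using True by (simp add: dual_eval_def)
    next
      case False
      then have le: "degree m \<le> degree p" using less.prems by (intro min) (auto simp: P_def)
      define n where "n = degree p - degree m"
      obtain b where b: "(lead_coeff p, b) \<in> R" using less.prems by (auto simp: dual_poly_def)
      \<comment> \<open>Leading coefficient of the quotient of \<open>p\<close> by \<open>m\<close>,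
        computed as a dual number with \<open>\<epsilon>\<close>-part \<open>w'\<close>.\<close>
      define w where "w = lead_coeff p * (1 / lead_coeff m)"
      define w' where "w' = b * (1 / lead_coeff m) + lead_coeff p * (- a / (lead_coeff m)\<^sup>2)"
      have w: "(monom w n, monom w' n) \<in> dual_poly R"
        unfolding w_def w'_def by (rule dual_poly_monom[OF R1 dual_mult[OF R1 b inv]])
      define r where "r = p - m * monom w n"
      define r' where "r' = p' - (m' * monom w n + m * monom w' n)"
      have rr: "(r, r') \<in> dual_poly R" unfolding r_def r'_def
        by (intro dual_poly_diff dual_poly_mult R1 less.prems m' w)
      have r0: "poly r s = 0" using less.prems m0 by (simp add: r_def)
      have w0: "w \<noteq> 0" using False m0 by (simp add: w_def)
      have dr: "degree r < degree p \<or> r = 0"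
      proof -
        have dw: "degree (monom w n) = n" using w0 by (simp add: degree_monom_eq)
        have "degree (m * monom w n) = degree p"
          using m0 w0 le dw by (simp add: degree_mult_eq n_def)
        moreover have "lead_coeff (m * monom w n) = lead_coeff p"
          unfolding lead_coeff_mult dw using m0 by (simp add: w_def)
        ultimately have "coeff r (degree p) = 0" "degree r \<le> degree p"
          by (simp_all add: r_def degree_diff_le)
        then show ?thesis
          using leading_coeff_0_iff[of r] by (cases "degree r = degree p") simp_all
      qed
      have "dual_eval s c r r' = 0"
      proof (cases "r = 0")
        case True
        then have "r' = 0" using dual_poly_zero[OF R] rr by simp
        then show ?thesis using True by (simp add: dual_eval_def)
      next
        case False
        then show ?thesis using dr by (intro less.hyps rr r0) simp
      qed
      moreover have "dual_eval s c r r' = dual_eval s c p p'"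
        unfolding r_def r'_def dual_eval_diff dual_eval_mult using em m0 by simp
      ultimately show ?thesis by simp
    qed
  qed
  from derivation_graph_adjoin[OF R this] show ?thesis by blast
qed

section \<open>Maximal derivations by Zorn's lemma\<close>

lemma derivation_graph_rats: "derivation_graph {(x::'a::field_char_0, 0) | x. x \<in> \<rat>}"
  by (auto simp: derivation_graph_def dual_subring_def)

lemma derivation_graph_Union:
  assumes chain: "subset.chain {R. derivation_graph R} \<C>" and ne: "\<C> \<noteq> {}"
  shows "derivation_graph (\<Union>\<C>)"
proof -
  have dg: "derivation_graph R" if "R \<in> \<C>" for R
    using that chain by (auto simp: subset.chain_def)
  then have ds: "dual_subring R" if "R \<in> \<C>" for R
    using that by (simp add: derivation_graph_def)
  have common: "\<exists>R\<in>\<C>. u \<in> R \<and> v \<in> R" if "u \<in> \<Union>\<C>" "v \<in> \<Union>\<C>" for u v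
    using that chain unfolding subset.chain_def by blast
  have "(1, 0) \<in> \<Union>\<C>" using ne ds dual_one by blast
  moreover have "(x - y, a - b) \<in> \<Union>\<C> \<and> (x * y, a * y + x * b) \<in> \<Union>\<C>"
    if "(x, a) \<in> \<Union>\<C>" "(y, b) \<in> \<Union>\<C>" for x a y b
    using common[OF that] ds dual_diff dual_mult by blast
  ultimately have "dual_subring (\<Union>\<C>)" unfolding dual_subring_def by blast
  then show ?thesis using dg unfolding derivation_graph_def by blast
qed

lemma derivation_graph_total:
  assumes R: "derivation_graph R" and dom: "Domain R = UNIV"
  obtains D where "derivation D" "\<And>x. (x, D x) \<in> R"
proof -
  have R1: "dual_subring R" using R by (rule derivation_graph_dual_subring)
  have "\<forall>x. \<exists>a. (x, a) \<in> R" using dom by blast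
  then obtain D where D: "\<And>x. (x, D x) \<in> R" by metis
  have uniq: "a = b" if "(x, a) \<in> R" "(x, b) \<in> R" for x a b
  proof -
    have "(0, a - b) \<in> R" using dual_diff[OF R1 that] by simp
    then show ?thesis using derivation_graph_zero[OF R] by force
  qed
  have "derivation D" unfolding derivation_def
    using uniq[OF D dual_add[OF R1 D D]] uniq[OF D dual_mult[OF R1 D D]] by blast
  then show ?thesis using D that by blast
qed

text \<open>The zero derivation on the rationals extends to \<open>t\<close> with value 1 because
  \<open>t\<close> is transcendental. A maximal graph above this one is total, since one of the two
  adjunctions would otherwise enlarge it.\<close>

lemma derivation_of_transcendental:
  fixes t :: "'a::field_char_0"
  assumes "\<not> algebraic t"
  obtains D where "derivation D" "D t = 1"
proof -
  have tr: "p = 0" if "\<forall>i. coeff p i \<in> Domain {(x::'a, 0::'a) | x. x \<in> \<rat>}" "poly p t = 0" for p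
    using assms that unfolding algebraic_altdef by auto
  obtain R0 where R0: "(t, 1) \<in> R0" "derivation_graph R0"
    using derivation_graph_adjoin_transcendental[OF derivation_graph_rats, of t 1] tr by blast
  define A where "A = {R. derivation_graph R \<and> R0 \<subseteq> R}"
  have "\<exists>M\<in>A. \<forall>X\<in>A. M \<subseteq> X \<longrightarrow> X = M"
  proof (rule subset_Zorn_nonempty)
    show "A \<noteq> {}" using R0 by (auto simp: A_def)
    fix \<C> assume ne: "\<C> \<noteq> {}" and ch: "subset.chain A \<C>"
    then have "subset.chain {R. derivation_graph R} \<C>"
      by (auto simp: subset.chain_def A_def)
    then have "derivation_graph (\<Union>\<C>)" by (rule derivation_graph_Union[OF _ ne])
    moreover have "R0 \<subseteq> \<Union>\<C>"
    proof -
      obtain R where "R \<in> \<C>" using ne by blast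
      moreover have "R0 \<subseteq> R" using \<open>R \<in> \<C>\<close> ch by (auto simp: subset.chain_def A_def)
      ultimately show ?thesis by blast
    qed
    ultimately show "\<Union>\<C> \<in> A" by (simp add: A_def)
  qed
  then obtain M where M: "derivation_graph M" "R0 \<subseteq> M"
    and max: "\<And>X. derivation_graph X \<Longrightarrow> M \<subseteq> X \<Longrightarrow> X = M"
    by (auto simp: A_def)
  have "s \<in> Domain M" for s
  proof (cases "\<exists>p. (\<forall>i. coeff p i \<in> Domain M) \<and> poly p s = 0 \<and> p \<noteq> 0")
    case True
    then show ?thesis using derivation_graph_adjoin_algebraic[OF M(1)] max by blast
  next
    case False
    then show ?thesis using derivation_graph_adjoin_transcendental[OF M(1), of s 0] max by blast
  qed
  then obtain D where D: "derivation D" "\<And>x. (x, D x) \<in> M"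
    using derivation_graph_total[OF M(1)] by blast
  have "(0, D t - 1) \<in> M"
    using dual_diff[OF derivation_graph_dual_subring[OF M(1)] D(2)[of t] subsetD[OF M(2) R0(1)]]
    by simp
  then have "D t = 1" using derivation_graph_zero[OF M(1)] by force
  then show ?thesis using that D by blast
qed

section \<open>Fourier analysis on a metric group\<close>

lemma sum_translate:
  fixes f :: "'a::{finite,ab_group_add} \<Rightarrow> 'b::comm_monoid_add"
  shows "(\<Sum>x\<in>UNIV. f (x + a)) = (\<Sum>x\<in>UNIV. f x)"
  by (rule sum.reindex_bij_witness[of _ "\<lambda>x. x - a" "\<lambda>x. x + a"]) auto

lemma sum_translate_diff:
  fixes f :: "'a::{finite,ab_group_add} \<Rightarrow> 'b::comm_monoid_add"
  shows "(\<Sum>x\<in>UNIV. f (x - a)) = (\<Sum>x\<in>UNIV. f x)"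
  using sum_translate[of f "- a"] by simp

lemma sum_reflect:
  fixes f :: "'a::{finite,ab_group_add} \<Rightarrow> 'b::comm_monoid_add"
  shows "(\<Sum>x\<in>UNIV. f (a - x)) = (\<Sum>x\<in>UNIV. f x)"
  by (rule sum.reindex_bij_witness[of _ "\<lambda>x. a - x" "\<lambda>x. a - x"]) auto

lemma sum_uminus:
  fixes f :: "'a::{finite,ab_group_add} \<Rightarrow> 'b::comm_monoid_add"
  shows "(\<Sum>x\<in>UNIV. f (- x)) = (\<Sum>x\<in>UNIV. f x)"
  using sum_reflect[of f 0] by simp

lemma sum_odd:
  fixes f :: "'a::{finite,ab_group_add} \<Rightarrow> 'b::field_char_0"
  assumes "\<And>x. f (- x) = - f x"
  shows "(\<Sum>x\<in>UNIV. f x) = 0"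
proof -
  have "(\<Sum>x\<in>UNIV. f x) = - (\<Sum>x\<in>UNIV. f x)"
    using sum_uminus[of f] by (simp add: assms sum_negf)
  then show ?thesis by (simp add: eq_neg_iff_add_eq_0 mult_2[symmetric])
qed

text \<open>Translating the sum of all values by \<open>y\<close> adds \<open>f y\<close> once per
  group element, and the target is torsion-free.\<close>

lemma additive_eq_0:
  fixes f :: "'a::{finite,ab_group_add} \<Rightarrow> 'b::field_char_0"
  assumes "\<And>x y. f (x + y) = f x + f y"
  shows "f y = 0"
proof -
  have "(\<Sum>x\<in>UNIV. f x) = (\<Sum>x\<in>UNIV. f x) + of_nat (card (UNIV :: 'a set)) * f y"
    using sum_translate[of f y] by (simp add: assms sum.distrib)
  then show ?thesis by simp
qed

locale metric =
  fixes q :: "'a::{finite,ab_group_add} \<Rightarrow> complex"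
  assumes metric_group: "metric_group q"
begin

abbreviation B :: "'a \<Rightarrow> 'a \<Rightarrow> complex" where "B \<equiv> polar q"

definition N :: complex where "N = of_nat (card (UNIV :: 'a set))"

definition s :: complex where "s = of_real (sqrt (real (card (UNIV :: 'a set))))"

lemma N_nz: "N \<noteq> 0"
  by (simp add: N_def)

lemma ss: "s * s = N"
  by (simp add: s_def N_def flip: of_real_mult)

lemma s_nz: "s \<noteq> 0"
  using ss N_nz by auto

lemma sum_const: "(\<Sum>x\<in>(UNIV :: 'a set). c) = N * c"
  by (simp add: N_def)

lemma q_nz: "q x \<noteq> 0"
  and q_minus: "q (- x) = q x"
  using metric_group by (auto simp: metric_group_def)

lemma B_nz: "B x y \<noteq> 0"
  and B_addl: "B (x + x') y = B x y * B x' y"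
  and B_addr: "B x (y + y') = B x y * B x y'"
  using metric_group by (auto simp: metric_group_def bicharacter_def)

lemma B_nondeg: "(\<And>y. B x y = 1) \<Longrightarrow> x = 0"
  using metric_group by (auto simp: metric_group_def nondegenerate_def)

lemma B_comm: "B x y = B y x"
  by (simp add: polar_def add.commute mult.commute)

lemma B_0l: "B 0 y = 1"
  using B_addl[of 0 0 y] B_nz[of 0 y] by simp

lemma B_0r: "B y 0 = 1"
  using B_0l B_comm by metis

lemma B_minusl: "B (- x) y = 1 / B x y"
  using B_addl[of x "- x" y] B_nz[of x y] by (simp add: B_0l field_simps)

lemma B_minusr: "B x (- y) = 1 / B x y"
  using B_minusl B_comm by metis

lemma B_diffl: "B (x - x') y = B x y / B x' y"
  using B_addl[of x "- x'" y] by (simp add: B_minusl)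

lemma B_diffr: "B x (y - y') = B x y / B x y'"
  using B_addr[of x y "- y'"] by (simp add: B_minusr)

lemma q_0: "q 0 = 1"
  using B_0l[of 0] q_nz[of 0] by (simp add: polar_def)

lemma q_add: "q (x + y) = q x * q y * B x y"
  using q_nz[of x] q_nz[of y] by (simp add: polar_def)

lemma q_diff: "q (x - y) = q x * q y / B x y"
  using q_add[of x "- y"] by (simp add: q_minus B_minusr)

lemma B_orth: "(\<Sum>x\<in>UNIV. B a x) = (if a = 0 then N else 0)"
proof (cases "a = 0")
  case True
  then show ?thesis by (simp add: B_0l sum_const del: sum_constant)
next
  case False
  then obtain y where y: "B a y \<noteq> 1" using B_nondeg by blast
  have "(\<Sum>x\<in>UNIV. B a x) = (\<Sum>x\<in>UNIV. B a x) * B a y"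
    using sum_translate[of "B a" y] by (simp add: B_addr sum_distrib_right)
  then show ?thesis using y False by simp
qed

text \<open>The unnormalised Fourier transform, with the group identified with its dual through
  \<open>B\<close>.\<close>

definition FT :: "('a \<Rightarrow> complex) \<Rightarrow> 'a \<Rightarrow> complex" where
  "FT f a = (\<Sum>x\<in>UNIV. f x * B a x)"

lemma FT_0: "FT f 0 = (\<Sum>x\<in>UNIV. f x)"
  by (simp add: FT_def B_0l)

lemma FT_translate: "(\<Sum>y\<in>UNIV. B b y * f (y - z)) = B b z * FT f b"
proof -
  have "(\<Sum>y\<in>UNIV. B b y * f (y - z)) = (\<Sum>y\<in>UNIV. B b (y + z) * f (y + z - z))"
    by (rule sum_translate[symmetric])
  then show ?thesis by (simp add: FT_def B_addr sum_distrib_left mult_ac)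
qed

lemma FT_conv: "FT (\<lambda>x. \<Sum>z\<in>UNIV. f z * g (x - z)) a = FT f a * FT g a"
proof -
  have "FT (\<lambda>x. \<Sum>z\<in>UNIV. f z * g (x - z)) a = (\<Sum>x\<in>UNIV. \<Sum>z\<in>UNIV. f z * (B a x * g (x - z)))"
    by (simp add: FT_def sum_distrib_left sum_distrib_right mult_ac)
  also have "\<dots> = (\<Sum>z\<in>UNIV. f z * (\<Sum>x\<in>UNIV. B a x * g (x - z)))"
    by (subst sum.swap) (simp add: sum_distrib_left)
  also have "\<dots> = FT f a * FT g a"
    by (simp add: FT_translate) (simp add: FT_def sum_distrib_right mult_ac)
  finally show ?thesis .
qed

lemma FT_mult: "FT (\<lambda>x. f x * FT g x) a = (\<Sum>u\<in>UNIV. g u * FT f (a + u))"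
proof -
  have "FT (\<lambda>x. f x * FT g x) a = (\<Sum>x\<in>UNIV. \<Sum>u\<in>UNIV. g u * (f x * B (a + u) x))"
    by (simp add: FT_def sum_distrib_right sum_distrib_left B_addr mult_ac B_comm)
  also have "\<dots> = (\<Sum>u\<in>UNIV. g u * FT f (a + u))"
    by (subst sum.swap) (simp add: FT_def sum_distrib_left)
  finally show ?thesis .
qed

lemma FT_FT: "FT (FT f) y = N * f (- y)"
proof -
  have "FT (FT f) y = FT (\<lambda>x. 1 * FT f x) y" by simp
  also have "\<dots> = (\<Sum>u\<in>UNIV. f u * (if y + u = 0 then N else 0))"
    by (subst FT_mult) (simp add: FT_def B_orth)
  also have "\<dots> = (\<Sum>u\<in>UNIV. if u = - y then f u * N else 0)"
    by (rule sum.cong) (auto simp: eq_neg_iff_add_eq_0 add.commute)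
  also have "\<dots> = N * f (- y)" by simp
  finally show ?thesis .
qed

lemma FT_inject:
  assumes "\<And>a. FT f a = FT g a"
  shows "f x = g x"
proof -
  have "FT f = FT g" using assms by blast
  then have "N * f (- (- x)) = N * g (- (- x))" unfolding FT_FT[symmetric] by simp
  then show ?thesis using N_nz by simp
qed

lemma FT_delta: "FT (\<lambda>x. if x = 0 then c else 0) a = c"
  by (simp add: FT_def B_0r if_distrib[where f = "\<lambda>t. t * _"] cong: if_cong)

lemma FT_const: "FT (\<lambda>x. c) a = (if a = 0 then N * c else 0)"
  using B_orth[of a] by (simp add: FT_def sum_distrib_left[symmetric] mult.commute)

lemma FT_add: "FT (\<lambda>x. f x + g x) a = FT f a + FT g a"
  by (simp add: FT_def sum.distrib algebra_simps)

lemma FT_cmult: "FT (\<lambda>x. c * f x) a = c * FT f a"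
  by (simp add: FT_def sum_distrib_left mult_ac)

lemma FT_uminus: "FT (\<lambda>x. f (- x)) a = FT f (- a)"
  using sum_uminus[of "\<lambda>x. f x * B (- a) x"] by (simp add: FT_def B_minusl B_minusr)

text \<open>Completing the square: \<open>q\<close> is a Gaussian, so \<open>q x * B a x\<close> is
  a translate of \<open>q\<close> up to the factor \<open>1 / q a\<close>.\<close>

lemma FT_chirp: "FT q a = (\<Sum>x\<in>UNIV. q x) / q a"
proof -
  have "q x * B a x = q (x + a) / q a" for x
    using q_nz by (simp add: q_add B_comm)
  then show ?thesis
    using sum_translate[of q a] by (simp add: FT_def sum_divide_distrib[symmetric])
qed

end

section \<open>Consequences of the pentagon relation\<close>

locale dilog = metric q for q :: "'a::{finite,ab_group_add} \<Rightarrow> complex" +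
  fixes E :: "'a \<Rightarrow> complex" and C :: complex
  assumes C_nz: "C \<noteq> 0"
    and pentagon: "\<And>x y. B x y * E x * E y =
       C + 1 / s * (\<Sum>z\<in>UNIV. E (y - z) * E z * q z * E (x - z))"
begin

text \<open>For fixed \<open>x\<close>, this is the Fourier transform of the part of the pentagon
  summand that does not involve \<open>y\<close>.\<close>

definition T :: "'a \<Rightarrow> 'a \<Rightarrow> complex" where
  "T x b = (\<Sum>z\<in>UNIV. E (x - z) * E z * q z * B b z)"

definition G :: "'a \<Rightarrow> complex" where
  "G x = q x * E x"

text \<open>Fourier transform of the pentagon relation in \<open>y\<close>: the factor
  \<open>B x y\<close> shifts the frequency by \<open>x\<close>, and the sum over \<open>z\<close>
  is a convolution in \<open>y\<close>.\<close>

lemma pentagon_FT: "E x * FT E (x + b) = (if b = 0 then C * N else 0) + 1 / s * FT E b * T x b"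
proof -
  have "E x * FT E (x + b) = (\<Sum>y\<in>UNIV. B b y * (B x y * E x * E y))"
    by (simp add: FT_def sum_distrib_left B_addl mult_ac)
  also have "\<dots> = C * (\<Sum>y\<in>UNIV. B b y) +
      1 / s * (\<Sum>y\<in>UNIV. \<Sum>z\<in>UNIV. E z * q z * E (x - z) * (B b y * E (y - z)))"
    unfolding pentagon by (simp add: distrib_left sum.distrib sum_distrib_left mult_ac)
  also have "(\<Sum>y\<in>UNIV. \<Sum>z\<in>UNIV. E z * q z * E (x - z) * (B b y * E (y - z))) =
      (\<Sum>z\<in>UNIV. E z * q z * E (x - z) * (\<Sum>y\<in>UNIV. B b y * E (y - z)))"
    by (subst sum.swap) (simp add: sum_distrib_left)
  also have "\<dots> = FT E b * T x b"
    by (simp add: FT_translate T_def sum_distrib_left mult_ac)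
  finally show ?thesis by (simp add: B_orth)
qed

lemma FT_E0_nz: "FT E 0 \<noteq> 0"
  using pentagon_FT[of 0 0] C_nz N_nz by auto

text \<open>By \<open>pentagon_FT\<close> the zeros of \<open>FT E\<close> are stable under
  translation by the support of \<open>E\<close>. This support generates the group, so one zero
  would force \<open>FT E 0 = 0\<close>.\<close>

lemma FT_E_nz: "FT E b \<noteq> 0"
proof
  assume Z: "FT E b = 0"
  define M where "M = {g. \<forall>b. FT E b = 0 \<longrightarrow> FT E (b + g) = 0}"
  have add: "g + h \<in> M" if "g \<in> M" "h \<in> M" for g h
    using that unfolding M_def by (auto simp: add.assoc[symmetric])
  have supp: "x \<in> M" if "E x \<noteq> 0" for x
  proof -
    have "FT E (c + x) = 0" if "FT E c = 0" for c
      using pentagon_FT[of x c] that \<open>E x \<noteq> 0\<close> FT_E0_nz by (auto simp: add.commute split: if_splits)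
    then show ?thesis by (simp add: M_def)
  qed
  have "x \<in> M" for x
  proof (rule ccontr)
    assume x: "x \<notin> M"
    \<comment> \<open>Otherwise \<open>x\<close> would be a sum of two shifts in \<open>M\<close>.
      Hence every term of the pentagon relation at \<open>(x, x)\<close> except \<open>C\<close>
      vanishes.\<close>
    have "E z * E (x - z) = 0" for z
      using add[OF supp[of z] supp[of "x - z"]] x by auto
    then have "E (x - z) * E z * q z * E (x - z) = 0" for z
      by (metis mult.commute mult_zero_left)
    then have "(\<Sum>z\<in>UNIV. E (x - z) * E z * q z * E (x - z)) = 0"
      by (intro sum.neutral ballI)
    moreover have "E x = 0" using supp x by blast
    ultimately show False using pentagon[of x x] C_nz by simp
  qed
  then have "- b \<in> M" by blast
  then have "FT E (b + - b) = 0" using Z unfolding M_def by blast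
  then show False using FT_E0_nz by simp
qed

lemma T_0: "T 0 b = FT (\<lambda>x. E x * E (- x) * q x) b"
  by (simp add: T_def FT_def mult_ac)

text \<open>A mean value; \<open>inversion\<close> shows the averaged function to be constant. The
  extra axiom for small groups says exactly \<open>k = 1\<close>.\<close>

definition k :: complex where
  "k = FT (\<lambda>x. E x * E (- x) * q x - (if x = 0 then s * E 0 else 0)) 0 / N"

text \<open>By \<open>pentagon_FT\<close> at \<open>x = 0\<close> and \<open>FT_E_nz\<close>,
  \<open>T 0 b = s * E 0\<close> for \<open>b \<noteq> 0\<close>. Removing the matching delta at 0
  leaves a function whose transform is supported at 0, hence a constant.\<close>

lemma inversion: "E x * E (- x) * q x = k + (if x = 0 then s * E 0 else 0)"
proof -
  define f where "f = (\<lambda>x. E x * E (- x) * q x - (if x = 0 then s * E 0 else 0))"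
  have "FT f b = FT (\<lambda>x. k) b" for b
  proof (cases "b = 0")
    case True
    then show ?thesis using N_nz by (simp add: FT_const k_def f_def)
  next
    case False
    have "FT f b = FT (\<lambda>x. E x * E (- x) * q x + (if x = 0 then - (s * E 0) else 0)) b"
      unfolding f_def by (rule arg_cong[where f = "\<lambda>f. FT f b"]) auto
    also have "\<dots> = T 0 b - s * E 0"
      by (simp add: FT_add FT_delta T_0)
    also have "\<dots> = 0"
      using pentagon_FT[of 0 b] False FT_E_nz[of b] s_nz by (simp add: field_simps)
    finally show ?thesis using False by (simp add: FT_const)
  qed
  then have "f x = k" by (rule FT_inject)
  then show ?thesis by (simp add: f_def diff_eq_eq)
qed

lemma C_N: "C * N = - k * s * FT E 0"
proof -
  have "T 0 0 = k * N + s * E 0"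
    unfolding T_0 inversion by (simp add: FT_add FT_delta FT_const)
  then have "E 0 * FT E 0 = C * N + 1 / s * FT E 0 * (k * N + s * E 0)"
    using pentagon_FT[of 0 0] by simp
  then have "C * N = - k * (N / s) * FT E 0"
    using s_nz by (simp add: field_simps eq_neg_iff_add_eq_0)
  also have "N / s = s" using ss s_nz by (simp add: field_simps)
  finally show ?thesis .
qed

lemma k_nz: "k \<noteq> 0"
  using C_N C_nz N_nz by auto

lemma E0_sq: "E 0 * E 0 = k + s * E 0"
  using inversion[of 0] by (simp add: q_0)

lemma E_nz: "E x \<noteq> 0"
  using inversion[of x] E0_sq k_nz by (cases "x = 0") auto

text \<open>The substitution of \<open>x - z\<close> for \<open>z\<close> swaps the two factors
  \<open>E\<close>, and the Gaussian absorbs the rest into a change of frequency.\<close>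

lemma T_sym: "T x b = q x * B b x * T x (- x - b)"
proof -
  have "T x b = (\<Sum>z\<in>UNIV. E (x - (x - z)) * E (x - z) * q (x - z) * B b (x - z))"
    unfolding T_def by (rule sum_reflect[symmetric])
  also have "\<dots> = (\<Sum>z\<in>UNIV. q x * B b x * (E (x - z) * E z * q z * B (- x - b) z))"
    by (rule sum.cong) (simp_all add: q_diff B_diffr B_diffl B_minusl)
  also have "\<dots> = q x * B b x * T x (- x - b)"
    by (simp add: T_def sum_distrib_left)
  finally show ?thesis .
qed

text \<open>Two instances of \<open>pentagon_FT\<close> with \<open>x = a - b\<close>, at
  frequencies \<open>b\<close> and \<open>- a\<close>, involve values of \<open>T\<close> that
  \<open>T_sym\<close> exchanges.\<close>

lemma FT_E_inversion:
  assumes "a \<noteq> 0" "b \<noteq> 0"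
  shows "FT E a * FT E (- a) * q b = FT E b * FT E (- b) * q a"
proof -
  define x where "x = a - b"
  have 1: "E x * FT E a = 1 / s * FT E b * T x b"
    using pentagon_FT[of x b] assms by (simp add: x_def)
  have 2: "E x * FT E (- b) = 1 / s * FT E (- a) * T x (- a)"
    using pentagon_FT[of x "- a"] assms by (simp add: x_def)
  have 3: "T x b * q b = q a * T x (- a)"
    using T_sym[of x b] q_add[of x b] by (simp add: x_def B_comm mult_ac)
  have "E x * (FT E a * FT E (- a) * q b) = 1 / s * FT E b * FT E (- a) * (T x b * q b)"
    unfolding mult.assoc[symmetric] 1 by (simp add: mult_ac)
  also have "\<dots> = FT E b * q a * (1 / s * FT E (- a) * T x (- a))"
    unfolding 3 by (simp add: mult_ac)
  also have "\<dots> = E x * (FT E b * FT E (- b) * q a)"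
    unfolding 2[symmetric] by (simp add: mult_ac)
  finally show ?thesis using E_nz[of x] by simp
qed

text \<open>\<open>T_sym\<close> also exchanges the frequencies 0 and \<open>- x\<close>.
  Eliminating \<open>T\<close> gives a linear equation between \<open>FT E (- x)\<close> and
  \<open>q x * E x\<close> with coefficients independent of \<open>x\<close>, and
  \<open>\<gamma>\<close> is their ratio.\<close>

lemma FT_E_eq:
  assumes "\<exists>a::'a. a \<noteq> 0"
  obtains \<gamma> where "\<gamma> \<noteq> 0" "\<And>x. x \<noteq> 0 \<Longrightarrow> FT E x = \<gamma> * q x * E (- x)"
    "FT E 0 * FT E 0 = k * s * \<gamma> * FT E 0 + k * \<gamma> * \<gamma>"
proof -
  obtain a :: 'a where a: "a \<noteq> 0" using assms by blast
  define \<kappa> where "\<kappa> = FT E a * FT E (- a) / q a"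
  have \<kappa>: "FT E x * FT E (- x) = \<kappa> * q x" if "x \<noteq> 0" for x
    using FT_E_inversion[OF that a] q_nz[of a] by (simp add: \<kappa>_def field_simps)
  define \<gamma> where "\<gamma> = (FT E 0 * FT E 0 - \<kappa>) / (k * s * FT E 0)"
  have 1: "FT E (- x) = \<gamma> * q x * E x" if x: "x \<noteq> 0" for x
  proof -
    have e1: "E x * FT E x = C * N + 1 / s * FT E 0 * T x 0"
      using pentagon_FT[of x 0] by simp
    have e2: "E x * FT E 0 = 1 / s * FT E (- x) * T x (- x)"
      using pentagon_FT[of x "- x"] x by simp
    have e3: "T x 0 = q x * T x (- x)"
      using T_sym[of x 0] by (simp add: B_0l)
    have "E x * (\<kappa> * q x) = E x * FT E x * FT E (- x)"
      using \<kappa>[OF x] by simp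
    also have "\<dots> = C * N * FT E (- x) + FT E 0 * q x * (1 / s * FT E (- x) * T x (- x))"
      unfolding e1 e3 by (simp add: algebra_simps)
    also have "\<dots> = - (k * s * FT E 0) * FT E (- x) + FT E 0 * q x * (E x * FT E 0)"
      unfolding e2[symmetric] C_N by simp
    finally have "k * s * FT E 0 * FT E (- x) = (FT E 0 * FT E 0 - \<kappa>) * (q x * E x)"
      by (simp add: algebra_simps)
    then show ?thesis using k_nz s_nz FT_E0_nz by (simp add: \<gamma>_def field_simps)
  qed
  have 2: "FT E x = \<gamma> * q x * E (- x)" if "x \<noteq> 0" for x
    using 1[of "- x"] that by (simp add: q_minus)
  have "\<gamma> \<noteq> 0" using 2[OF a] FT_E_nz[of a] by auto
  \<comment> \<open>Evaluating \<open>\<kappa>\<close> by the new formula gives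
    \<open>\<gamma> * \<gamma> * k\<close>, which turns the definition of \<open>\<gamma>\<close>
    into the quadratic relation.\<close>
  moreover have "FT E 0 * FT E 0 = k * s * \<gamma> * FT E 0 + k * \<gamma> * \<gamma>"
  proof -
    have "\<kappa> * q a = \<gamma> * \<gamma> * q a * (E a * E (- a) * q a)"
      unfolding \<kappa>[OF a, symmetric] 2[OF a] 1[OF a] by (simp add: mult_ac)
    then have "\<kappa> = \<gamma> * \<gamma> * k" using a q_nz[of a] by (simp add: inversion)
    moreover have "\<gamma> * (k * s * FT E 0) = FT E 0 * FT E 0 - \<kappa>"
      using k_nz s_nz FT_E0_nz by (simp add: \<gamma>_def)
    ultimately show ?thesis by (simp add: algebra_simps)
  qed
  ultimately show ?thesis using 2 that by blast
qed

end

section \<open>Constant metrics, and derivations on the values of \<open>q\<close>\<close>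

context metric
begin

text \<open>Constancy gives \<open>B x z = 1 / c\<close> whenever \<open>z\<close> and
  \<open>x + z\<close> are nonzero. Multiplicativity in \<open>z\<close> then forces
  \<open>c = 1\<close>, so \<open>B\<close> is trivial.\<close>

lemma card_le_4_of_constant:
  assumes c: "\<And>x. x \<noteq> 0 \<Longrightarrow> q x = c"
  shows "card (UNIV :: 'a set) \<le> 4"
proof (rule ccontr)
  assume big: "\<not> card (UNIV :: 'a set) \<le> 4"
  have ex: "\<exists>y. y \<notin> set xs" if "length xs \<le> 4" for xs :: "'a list"
  proof (rule ccontr)
    assume "\<nexists>y. y \<notin> set xs"
    then have "set xs = UNIV" by blast
    then show False using card_length[of xs] that big by simp
  qed
  obtain x :: 'a where x: "x \<noteq> 0" using ex[of "[0]"] by auto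
  obtain y where y: "y \<noteq> 0" "x + y \<noteq> 0"
    using ex[of "[0, - x]"] by (auto simp: add_eq_0_iff)
  \<comment> \<open>Four values must be avoided: this is where a fifth element is needed.\<close>
  obtain y' where "y' \<notin> set [0, - x, - y, - (x + y)]"
    using ex[of "[0, - x, - y, - (x + y)]"] by auto
  then have y': "y' \<noteq> 0" "x + y' \<noteq> 0" "y + y' \<noteq> 0" "x + (y + y') \<noteq> 0"
    using add_eq_0_iff[of x y'] add_eq_0_iff[of y y'] add_eq_0_iff[of "x + y" y']
    by (auto simp: add.assoc)
  have c0: "c \<noteq> 0" using c[OF x] q_nz[of x] by simp
  have B: "B x z = 1 / c" if "z \<noteq> 0" "x + z \<noteq> 0" for z
    using c[OF x] c[OF that(1)] c[OF that(2)] by (simp add: polar_def)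
  have "1 / c = 1 / c * (1 / c)"
    using B_addr[of x y y'] by (simp only: B[OF y] B[OF y'(1,2)] B[OF y'(3,4)])
  then have "c = 1" using c0 by simp
  then have "q z = 1" for z using c[of z] q_0 by (cases "z = 0") simp_all
  then have "B x z = 1" for z by (simp add: polar_def)
  then show False using B_nondeg x by blast
qed

lemma derivation_s:
  assumes D: "derivation D"
  shows "D s = 0"
proof -
  have "D (s * s) = 0" unfolding ss N_def by (rule derivation_of_nat[OF D])
  then have "2 * (s * D s) = 0" by (simp add: derivation_mult[OF D])
  then show ?thesis using s_nz by simp
qed

text \<open>Logarithmic derivatives turn \<open>B\<close> into a biadditive map into a torsion-free group.\<close>

lemma
  assumes D: "derivation D"
  shows derivation_B: "D (B x y) = 0"
    and derivation_q: "D (q x) = 0"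
proof -
  note Dm = derivation_mult[OF D]
  have B0: "D (B x y) = 0" for x y
  proof -
    define f where "f = (\<lambda>x. D (B x y) / B x y)"
    have "f (x + x') = f x + f x'" for x x'
      using B_nz[of x y] B_nz[of x' y] by (simp add: f_def B_addl Dm field_simps)
    then have "f x = 0" by (rule additive_eq_0)
    then show ?thesis using B_nz by (simp add: f_def)
  qed
  show "D (B x y) = 0" by (rule B0)
  define f where "f = (\<lambda>x. D (q x) / q x)"
  have "f (x + y) = f x + f y" for x y
    using q_nz[of x] q_nz[of y] B_nz[of x y] by (simp add: f_def q_add Dm B0 field_simps)
  then have "f x = 0" by (rule additive_eq_0)
  then show "D (q x) = 0" using q_nz by (simp add: f_def)
qed

lemma derivation_FT:
  assumes D: "derivation D"
  shows "D (FT f a) = FT (\<lambda>x. D (f x)) a"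
  by (simp add: FT_def derivation_sum[OF D] derivation_mult[OF D] derivation_B[OF D])

end

section \<open>Regular and exceptional solutions\<close>

context dilog
begin

lemma T_conv: "T x 0 = (\<Sum>z\<in>UNIV. G z * E (x - z))"
  by (simp add: T_def G_def B_0l mult_ac)

lemma FT_T: "FT (\<lambda>x. T x 0) a = FT G a * FT E a"
  by (simp add: T_conv FT_conv)

lemma two_E0:
  assumes k_1: "k = 1"
  shows "2 * E 0 - s \<noteq> 0"
proof
  assume "2 * E 0 - s = 0"
  then have "0 = (2 * E 0 - s) * (2 * E 0 - s)" by simp
  also have "\<dots> = 4 * (E 0 * E 0) - 4 * s * E 0 + s * s" by (simp add: algebra_simps)
  also have "\<dots> = of_nat (card (UNIV :: 'a set) + 4)"
    by (simp add: E0_sq k_1 ss N_def algebra_simps)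
  finally show False by (metis of_nat_eq_0_iff add_is_0 zero_neq_numeral)
qed

text \<open>\<open>E 0\<close> is a simple root of a quadratic polynomial with coefficients killed
  by \<open>D\<close>.\<close>

lemma derivation_E0:
  assumes D: "derivation D" and k_1: "k = 1"
  shows "D (E 0) = 0"
proof -
  have "D (E 0 * E 0) = D (1 + s * E 0)" by (simp add: E0_sq k_1)
  then have "(2 * E 0 - s) * D (E 0) = 0"
    by (simp add: derivation_mult[OF D] derivation_add[OF D] derivation_s[OF D]
      derivation_1[OF D] algebra_simps)
  then show ?thesis using two_E0[OF k_1] by simp
qed

text \<open>The question is whether the formula of \<open>FT_E_eq\<close> extends to
  \<open>x = 0\<close>. If so, comparing the quadratic relations of \<open>FT E 0\<close> and
  \<open>E 0\<close> gives \<open>k = 1\<close>. If not, \<open>T x 0\<close> is constant off 0, and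
  its Fourier transform determines \<open>q a * E (- a)\<close>.\<close>

lemma regular_or_exceptional:
  assumes "\<exists>a::'a. a \<noteq> 0"
  obtains (regular) \<gamma> where "\<gamma> \<noteq> 0" "\<And>x. FT E x = \<gamma> * q x * E (- x)" "k = 1"
    | (exceptional) \<gamma> where "\<gamma> \<noteq> 0" "\<And>x. x \<noteq> 0 \<Longrightarrow> \<gamma> * q x * E (- x) = s"
proof -
  obtain \<gamma> where \<gamma>: "\<gamma> \<noteq> 0" "\<And>x. x \<noteq> 0 \<Longrightarrow> FT E x = \<gamma> * q x * E (- x)"
    "FT E 0 * FT E 0 = k * s * \<gamma> * FT E 0 + k * \<gamma> * \<gamma>"
    using FT_E_eq assms by blast
  define r where "r = FT E 0 / \<gamma>"
  have r: "FT E 0 = \<gamma> * r" using \<gamma> by (simp add: r_def)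
  show ?thesis
  proof (cases "r = E 0")
    case True
    then have F: "FT E x = \<gamma> * q x * E (- x)" for x
      using \<gamma>(2)[of x] r by (cases "x = 0") (auto simp: q_0)
    have "\<gamma> * \<gamma> * (E 0 * E 0) = \<gamma> * \<gamma> * (k * s * E 0 + k)"
      using \<gamma>(3) unfolding r True by (simp add: algebra_simps)
    then have "k + s * E 0 = k * s * E 0 + k" using \<gamma>(1) E0_sq by simp
    then have "k = 1" using s_nz E_nz[of 0] by simp
    then show ?thesis using F \<gamma>(1) regular by blast
  next
    case False
    have T1: "T x 0 = s * r" if x: "x \<noteq> 0" for x
    proof -
      have "E x * FT E 0 = 1 / s * FT E (- x) * T x (- x)"
        using pentagon_FT[of x "- x"] x by simp
      moreover have "T x 0 = q x * T x (- x)"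
        using T_sym[of x 0] by (simp add: B_0l)
      ultimately have "E x * (\<gamma> * r) = 1 / s * \<gamma> * E x * T x 0"
        using \<gamma>(2)[of "- x"] x by (simp add: r q_minus)
      then show ?thesis using E_nz[of x] \<gamma>(1) s_nz by (simp add: field_simps)
    qed
    have "T 0 0 = k * N + s * E 0"
      unfolding T_0 inversion by (simp add: FT_add FT_delta FT_const)
    then have T2: "(\<lambda>x. T x 0) = (\<lambda>x. s * r + (if x = 0 then k * N + s * E 0 - s * r else 0))"
      using T1 by auto
    have 1: "FT G a * FT E a = k * N + s * E 0 - s * r" if "a \<noteq> 0" for a
      using FT_T[of a] that unfolding T2 by (simp add: FT_add FT_const FT_delta)
    \<comment> \<open>The failure at 0 enters as a delta, which a second transform turns into an
      additive constant.\<close>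
    have "FT E = (\<lambda>x. \<gamma> * G (- x) + (if x = 0 then \<gamma> * (r - E 0) else 0))"
      using \<gamma>(2) by (auto simp: r q_minus q_0 G_def algebra_simps)
    then have "FT (FT E) (- a) = \<gamma> * FT G a + \<gamma> * (r - E 0)" for a
      by (simp add: FT_add FT_delta FT_cmult FT_uminus)
    then have 2: "\<gamma> * FT G a = N * E a - \<gamma> * (r - E 0)" for a
      by (simp add: FT_FT)
    \<comment> \<open>Two expressions for \<open>FT G a * FT E a\<close> are compared. The terms
      with \<open>k * N\<close> cancel, leaving the nonzero common factor
      \<open>r - E 0\<close>.\<close>
    have "\<gamma> * q a * E (- a) = s" if a: "a \<noteq> 0" for a
    proof -
      have "\<gamma> * (k * N + s * E 0 - s * r) = (N * E a - \<gamma> * (r - E 0)) * (\<gamma> * q a * E (- a))"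
        unfolding 1[OF a, symmetric] 2[symmetric] \<gamma>(2)[OF a] by simp
      also have "\<dots> = \<gamma> * N * (E a * E (- a) * q a) - \<gamma> * (r - E 0) * (\<gamma> * q a * E (- a))"
        by (simp add: algebra_simps)
      also have "E a * E (- a) * q a = k" using a by (simp add: inversion)
      finally have "\<gamma> * (r - E 0) * (\<gamma> * q a * E (- a)) = \<gamma> * (r - E 0) * s"
        by (simp add: algebra_simps)
      then show ?thesis using \<gamma>(1) False by simp
    qed
    then show ?thesis using \<gamma>(1) exceptional by blast
  qed
qed

end

section \<open>Infinitesimal rigidity\<close>

locale regular_dilog = dilog q E C
  for q :: "'a::{finite,ab_group_add} \<Rightarrow> complex" and E C +
  fixes \<gamma> :: complex and D :: "complex \<Rightarrow> complex"
  assumes \<gamma>_nz: "\<gamma> \<noteq> 0"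
    and FT_E: "\<And>x. FT E x = \<gamma> * q x * E (- x)"
    and k_1: "k = 1"
    and D: "derivation D"
begin

lemmas D_add = derivation_add[OF D]
lemmas D_mult = derivation_mult[OF D]
lemmas D_sum = derivation_sum[OF D]
lemmas D_q = derivation_q[OF D]
lemmas D_B = derivation_B[OF D]
lemmas D_s = derivation_s[OF D]

lemma E_inv: "E x * E (- x) * q x = 1 + (if x = 0 then s * E 0 else 0)"
  using inversion by (simp add: k_1)

lemma FT_G: "FT G a = N / \<gamma> * E a"
proof -
  have "FT E = (\<lambda>x. \<gamma> * G (- x))" by (auto simp: FT_E G_def q_minus)
  then have "FT (FT E) (- a) = \<gamma> * FT G a" by (simp add: FT_cmult FT_uminus)
  then show ?thesis using \<gamma>_nz by (simp add: FT_FT)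
qed

text \<open>The transform of this convolution of \<open>G\<close> and \<open>E\<close> is
  \<open>N\<close> times the product in \<open>E_inv\<close>. So \<open>G\<close> inverts
  \<open>E\<close> up to scaling and an additive constant.\<close>

lemma T_eq: "T x 0 = s * E 0 + (if x = 0 then N else 0)"
proof (rule FT_inject[where f = "\<lambda>x. T x 0"])
  fix a
  have "FT (\<lambda>x. T x 0) a = N * (E a * E (- a) * q a)"
    using \<gamma>_nz by (simp add: FT_T FT_G FT_E)
  also have "\<dots> = N * (1 + (if a = 0 then s * E 0 else 0))" by (simp only: E_inv)
  finally show "FT (\<lambda>x. T x 0) a = FT (\<lambda>x. s * E 0 + (if x = 0 then N else 0)) a"
    by (simp add: FT_add FT_delta FT_const algebra_simps)
qed

text \<open>Completing the square writes \<open>N / \<gamma> * G\<close> as the convolution of the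
  reflected \<open>E\<close> with \<open>q\<close>; then both sides are summed over the group. This
  makes \<open>\<gamma>\<close> algebraic over the values of \<open>q\<close>, hence killed by
  \<open>D\<close>.\<close>

lemma gauss_sum: "(\<Sum>x\<in>UNIV. q x) * (\<gamma> * \<gamma> * \<gamma>) = N * N"
proof -
  have "N / \<gamma> * G y = (\<Sum>x\<in>UNIV. E (- x) * q (y - x))" for y
  proof -
    have "N / \<gamma> * G y = q y * FT G y" by (simp add: FT_G G_def)
    also have "\<dots> = (\<Sum>x\<in>UNIV. E (- (- x)) * q (y - (- x)))"
      by (simp add: FT_def G_def q_add sum_distrib_left mult_ac B_comm)
    also have "\<dots> = (\<Sum>x\<in>UNIV. E (- x) * q (y - x))" by (rule sum_uminus)
    finally show ?thesis .
  qed
  then have "FT (\<lambda>y. N / \<gamma> * G y) 0 = FT (\<lambda>x. E (- x)) 0 * FT q 0"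
    using FT_conv[of "\<lambda>x. E (- x)" q 0] by simp
  then have "N / \<gamma> * (N / \<gamma> * E 0) = \<gamma> * E 0 * (\<Sum>x\<in>UNIV. q x)"
    by (simp only: FT_cmult FT_G FT_uminus FT_chirp) (simp add: FT_E q_0)
  then show ?thesis using \<gamma>_nz E_nz[of 0] by (simp add: field_simps)
qed

lemma D_\<gamma>: "D \<gamma> = 0"
proof -
  define g where "g = (\<Sum>x\<in>UNIV. q x)"
  have g: "g * (\<gamma> * \<gamma> * \<gamma>) = N * N" using gauss_sum by (simp add: g_def)
  have "D g = 0" by (simp add: g_def D_sum D_q)
  moreover have "D (g * (\<gamma> * \<gamma> * \<gamma>)) = 0"
    unfolding g N_def by (simp add: D_mult derivation_of_nat[OF D])
  ultimately have "3 * (g * \<gamma> * \<gamma> * D \<gamma>) = 0" by (simp add: D_mult algebra_simps)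
  moreover have "g \<noteq> 0" using g N_nz by auto
  ultimately show ?thesis using \<gamma>_nz by simp
qed

lemma C_eq: "C * N = - s * \<gamma> * E 0"
  by (simp add: C_N k_1 FT_E q_0)

section \<open>The logarithmic derivative of a solution\<close>

definition e :: "'a \<Rightarrow> complex" where "e x = D (E x)"

definition \<phi> :: "'a \<Rightarrow> complex" where "\<phi> x = e x / E x"

definition \<psi> :: "'a \<Rightarrow> complex" where "\<psi> = FT \<phi>"

lemma e_eq: "e x = E x * \<phi> x"
  using E_nz[of x] by (simp add: \<phi>_def)

lemma e_0: "e 0 = 0"
  using derivation_E0[OF D k_1] by (simp add: e_def)

lemma \<phi>_0: "\<phi> 0 = 0"
  by (simp add: \<phi>_def e_0)

lemma \<phi>_minus: "\<phi> (- x) = - \<phi> x"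
proof (cases "x = 0")
  case False
  then have "D (E x * E (- x) * q x) = 0" by (simp add: E_inv derivation_1[OF D])
  then have "(e x * E (- x) + E x * e (- x)) * q x = 0" by (simp add: D_mult D_q e_def)
  then have "q x * (E x * E (- x) * (\<phi> x + \<phi> (- x))) = 0"
    by (simp add: e_eq algebra_simps)
  then show ?thesis using q_nz[of x] E_nz[of x] E_nz[of "- x"] by (simp add: eq_neg_iff_add_eq_0 add.commute)
qed (simp add: \<phi>_0)

text \<open>The exceptional term of \<open>E_inv\<close> sits at 0, where \<open>\<phi>\<close>
  vanishes.\<close>

lemma E_inv_\<phi>: "E x * E (- x) * q x * \<phi> x = \<phi> x"
  by (simp add: E_inv \<phi>_0)

lemma sum_\<phi>: "(\<Sum>x\<in>UNIV. \<phi> x) = 0"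
  by (rule sum_odd) (rule \<phi>_minus)

lemma \<psi>_minus: "\<psi> (- x) = - \<psi> x"
proof -
  have "\<psi> (- x) = FT (\<lambda>x. \<phi> (- x)) x" by (simp add: FT_uminus \<psi>_def)
  also have "\<dots> = - \<psi> x" by (simp add: \<phi>_minus \<psi>_def FT_def sum_negf)
  finally show ?thesis .
qed

lemma \<psi>_0: "\<psi> 0 = 0"
  by (simp add: \<psi>_def FT_0 sum_\<phi>)

lemma FT_e: "FT e x = \<gamma> * q x * e (- x)"
proof -
  have "e = (\<lambda>x. D (E x))" by (auto simp: e_def)
  then have "FT e x = D (FT E x)" by (simp add: derivation_FT[OF D])
  then show ?thesis by (simp add: FT_E D_mult D_\<gamma> D_q e_def)
qed

lemma D_C: "D C = 0"
proof -
  have "D (C * N) = 0"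
    unfolding C_eq using e_0 by (simp add: D_mult D_s D_\<gamma> derivation_minus[OF D] e_def)
  then show ?thesis using N_nz by (simp add: D_mult N_def derivation_of_nat[OF D])
qed

text \<open>The terms are grouped by whether \<open>D\<close> falls on \<open>E (y - z)\<close>, so
  that both sums are convolutions in \<open>y\<close>, with \<open>e\<close> and with
  \<open>E\<close>.\<close>

lemma pentagon_D:
  "B x y * (e x * E y + E x * e y) = 1 / s * (\<Sum>z\<in>UNIV. e (y - z) * (G z * E (x - z))) +
     1 / s * (\<Sum>z\<in>UNIV. E (y - z) * (q z * (e z * E (x - z) + E z * e (x - z))))"
proof -
  have "D (B x y * E x * E y) = B x y * (e x * E y + E x * e y)"
    by (simp add: D_mult D_B e_def algebra_simps)
  moreover have "D (C + 1 / s * (\<Sum>z\<in>UNIV. E (y - z) * E z * q z * E (x - z))) =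
      (\<Sum>z\<in>UNIV. e (y - z) * (G z * E (x - z)) +
        E (y - z) * (q z * (e z * E (x - z) + E z * e (x - z)))) / s"
    by (simp add: D_add D_C derivation_const_divide[OF D D_s] D_sum D_mult D_q e_def G_def algebra_simps)
  ultimately show ?thesis
    unfolding pentagon by (simp add: sum.distrib add_divide_distrib)
qed

lemma G_conv_e: "(\<Sum>z\<in>UNIV. G z * e (x - z)) = \<psi> x"
proof (rule FT_inject)
  fix a
  have "FT (\<lambda>x. \<Sum>z\<in>UNIV. G z * e (x - z)) a = N * (E a * E (- a) * q a * \<phi> (- a))"
    unfolding FT_conv FT_G FT_e using \<gamma>_nz by (simp add: e_eq)
  also have "\<dots> = N * \<phi> (- a)" by (simp add: \<phi>_minus E_inv_\<phi>)
  also have "\<dots> = FT \<psi> a" by (simp add: \<psi>_def FT_FT)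
  finally show "FT (\<lambda>x. \<Sum>z\<in>UNIV. G z * e (x - z)) a = FT \<psi> a" .
qed

text \<open>\<open>FT G\<close> is a multiple of \<open>E\<close>, so its product with the reflected
  \<open>\<phi>\<close> is a multiple of \<open>D (FT G a)\<close>, and \<open>D\<close> commutes
  with the transform.\<close>

lemma G_conv_\<psi>: "(\<Sum>z\<in>UNIV. G z * \<psi> (x - z)) = - N * (q x * e x)"
proof (rule FT_inject)
  fix a
  have "FT (\<lambda>x. \<Sum>z\<in>UNIV. G z * \<psi> (x - z)) a = N / \<gamma> * E a * (N * \<phi> (- a))"
    by (simp add: FT_conv FT_G \<psi>_def FT_FT)
  also have "\<dots> = - N * (N / \<gamma> * e a)" by (simp add: \<phi>_minus e_eq)
  also have "N / \<gamma> * e a = D (FT G a)"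
    by (simp add: FT_G D_mult derivation_const_divide[OF D D_\<gamma>] N_def derivation_of_nat[OF D] e_def)
  also have "\<dots> = FT (\<lambda>x. q x * e x) a"
    by (simp add: derivation_FT[OF D] G_def D_mult D_q e_def)
  finally show "FT (\<lambda>x. \<Sum>z\<in>UNIV. G z * \<psi> (x - z)) a = FT (\<lambda>x. - N * (q x * e x)) a"
    by (simp only: FT_cmult)
qed

section \<open>Contraction with the convolution inverse of \<open>E\<close>\<close>

text \<open>\<open>K\<close> is \<open>N\<close> times the convolution inverse of \<open>E\<close>.\<close>

definition K :: "'a \<Rightarrow> complex" where "K x = G x - s / \<gamma>"

lemma sum_reflect_conv:
  fixes f g :: "'a \<Rightarrow> complex"
  shows "(\<Sum>y\<in>UNIV. f (u - y) * g (y - z)) = (\<Sum>w\<in>UNIV. f w * g (u - z - w))"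
  using sum_reflect[of "\<lambda>y. f (u - y) * g (y - z)" u] by (simp add: algebra_simps)

lemma G_conv_E': "(\<Sum>y\<in>UNIV. G (u - y) * E (y - z)) = s * E 0 + (if u = z then N else 0)"
  unfolding sum_reflect_conv by (simp add: T_conv[symmetric] T_eq)

text \<open>Since \<open>E\<close> sums to \<open>\<gamma> * E 0\<close>, the constant
  \<open>s / \<gamma>\<close> in \<open>K\<close> cancels the term \<open>s * E 0\<close> of
  \<open>G_conv_E'\<close>.\<close>

lemma K_conv_E: "(\<Sum>y\<in>UNIV. K (u - y) * E (y - z)) = (if u = z then N else 0)"
proof -
  have "(\<Sum>y\<in>UNIV. E (y - z)) = \<gamma> * E 0"
    using FT_E[of 0] by (simp add: sum_translate_diff FT_0 q_0)
  then have "(\<Sum>y\<in>UNIV. s / \<gamma> * E (y - z)) = s * E 0"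
    using \<gamma>_nz by (simp only: sum_distrib_left[symmetric]) simp
  then show ?thesis
    by (simp add: K_def left_diff_distrib sum_subtractf G_conv_E')
qed

lemma K_conv_e: "(\<Sum>y\<in>UNIV. K (u - y) * e (y - z)) = \<psi> (u - z)"
proof -
  have "(\<Sum>y\<in>UNIV. e (y - z)) = 0"
    using FT_e[of 0] by (simp add: sum_translate_diff FT_0 e_0)
  then have "(\<Sum>y\<in>UNIV. s / \<gamma> * e (y - z)) = 0"
    by (simp only: sum_distrib_left[symmetric]) simp
  moreover have "(\<Sum>y\<in>UNIV. G (u - y) * e (y - z)) = \<psi> (u - z)"
    unfolding sum_reflect_conv by (rule G_conv_e)
  ultimately show ?thesis
    by (simp add: K_def left_diff_distrib sum_subtractf)
qed

lemma C_sum_K: "C * (\<Sum>y\<in>UNIV. K (u - y)) = - s"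
proof -
  have "(\<Sum>y\<in>UNIV. K (u - y)) = FT G 0 - N * (s / \<gamma>)"
    by (simp only: sum_reflect K_def sum_subtractf FT_0 sum_const)
  also have "\<dots> = N * ((E 0 - s) / \<gamma>)" by (simp add: FT_G algebra_simps diff_divide_distrib)
  finally have "C * (\<Sum>y\<in>UNIV. K (u - y)) = C * N * ((E 0 - s) / \<gamma>)" by simp
  also have "\<dots> = - s * (E 0 * E 0 - s * E 0)"
    unfolding C_eq using \<gamma>_nz by (simp add: algebra_simps diff_divide_distrib)
  finally show ?thesis by (simp add: E0_sq k_1)
qed

lemma sum_K_conv:
  "(\<Sum>y\<in>UNIV. K (u - y) * (\<Sum>z\<in>UNIV. f (y - z) * h z)) =
     (\<Sum>z\<in>UNIV. h z * (\<Sum>y\<in>UNIV. K (u - y) * f (y - z)))"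
  unfolding sum_distrib_left by (subst sum.swap) (simp add: mult_ac)

lemma sum_K_conv_E:
  "(\<Sum>y\<in>UNIV. K (u - y) * (\<Sum>z\<in>UNIV. E (y - z) * h z)) = N * h u"
  by (simp add: sum_K_conv K_conv_E if_distrib[where f = "\<lambda>t. _ * t"] cong: if_cong)

text \<open>The contraction with \<open>K\<close> of the left-hand term in which \<open>D\<close>
  falls on \<open>E y\<close>, without its factor \<open>E x\<close>.\<close>

definition Q :: "'a \<Rightarrow> 'a \<Rightarrow> complex" where
  "Q u x = (\<Sum>y\<in>UNIV. K (u - y) * B x y * e y)"

lemma N_s: "1 / s * (N * x) = s * x"
  using ss s_nz by (simp add: field_simps flip: ss)

text \<open>\<open>K\<close> undoes the convolution with \<open>E\<close>, so only the summand at
  \<open>z = u\<close> survives.\<close>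

lemma K_pentagon: "E x * (\<Sum>y\<in>UNIV. K (u - y) * B x y * E y) = s * (G u * E (x - u)) - s"
proof -
  have "E x * (\<Sum>y\<in>UNIV. K (u - y) * B x y * E y) = (\<Sum>y\<in>UNIV. K (u - y) * (B x y * E x * E y))"
    by (simp add: sum_distrib_left mult_ac)
  also have "\<dots> = C * (\<Sum>y\<in>UNIV. K (u - y)) +
      1 / s * (\<Sum>y\<in>UNIV. K (u - y) * (\<Sum>z\<in>UNIV. E (y - z) * (G z * E (x - z))))"
    unfolding pentagon by (simp add: G_def sum.distrib sum_distrib_left algebra_simps)
  also have "\<dots> = s * (G u * E (x - u)) - s"
    unfolding sum_K_conv_E N_s C_sum_K by simp
  finally show ?thesis .
qed

text \<open>The same contraction of \<open>pentagon_D\<close>; by \<open>K_conv_e\<close> the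
  convolution with \<open>e\<close> turns into \<open>\<psi>\<close>.\<close>

lemma K_pentagon_D:
  "\<phi> x * (s * (G u * E (x - u)) - s) + E x * Q u x =
     s * (q u * (e u * E (x - u) + E u * e (x - u))) +
     1 / s * (\<Sum>z\<in>UNIV. G z * E (x - z) * \<psi> (u - z))"
proof -
  have "\<phi> x * (s * (G u * E (x - u)) - s) + E x * Q u x =
      (\<Sum>y\<in>UNIV. K (u - y) * (B x y * (e x * E y + E x * e y)))"
    unfolding K_pentagon[symmetric] Q_def
    by (simp add: e_eq[of x] sum.distrib sum_distrib_left algebra_simps)
  also have "\<dots> = 1 / s * (\<Sum>y\<in>UNIV. K (u - y) * (\<Sum>z\<in>UNIV. e (y - z) * (G z * E (x - z)))) +
      1 / s * (\<Sum>y\<in>UNIV. K (u - y) *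
        (\<Sum>z\<in>UNIV. E (y - z) * (q z * (e z * E (x - z) + E z * e (x - z)))))"
    unfolding pentagon_D by (simp add: distrib_left sum.distrib sum_distrib_left mult_ac)
  also have "\<dots> = 1 / s * (\<Sum>z\<in>UNIV. G z * E (x - z) * \<psi> (u - z)) +
      s * (q u * (e u * E (x - u) + E u * e (x - u)))"
    unfolding sum_K_conv_E N_s unfolding sum_K_conv[of u e "\<lambda>z. G z * E (x - z)"] K_conv_e by simp
  finally show ?thesis by simp
qed

text \<open>The case \<open>u = 0\<close> of \<open>K_pentagon_D\<close>, where
  \<open>e 0 = 0\<close> and the terms with \<open>E 0\<close> cancel.\<close>

lemma \<psi>_relation: "s * (E x * \<psi> x) = - (\<Sum>z\<in>UNIV. G z * \<psi> z * E (x - z))"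
proof -
  have "Q 0 x = \<psi> x - s / \<gamma> * FT e x"
  proof -
    have "G (- y) * e y = \<phi> y" for y
      using E_inv_\<phi>[of y] by (simp add: G_def e_eq q_minus mult_ac)
    then have "K (0 - y) * B x y * e y = \<phi> y * B x y - s / \<gamma> * (e y * B x y)" for y
      by (simp add: K_def algebra_simps)
    then show ?thesis
      by (simp only: Q_def sum_subtractf sum_distrib_left[symmetric] \<psi>_def FT_def)
  qed
  moreover have "E x * (s / \<gamma> * FT e x) = - (s * \<phi> x)"
    using \<gamma>_nz E_inv_\<phi>[of x] by (simp add: FT_e e_eq \<phi>_minus mult_ac)
  ultimately have Q0: "E x * Q 0 x = E x * \<psi> x + s * \<phi> x"
    by (simp only: right_diff_distrib diff_minus_eq_add)
  have "E x * \<psi> x = 1 / s * (\<Sum>z\<in>UNIV. G z * E (x - z) * \<psi> (0 - z))"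
    using K_pentagon_D[of x 0] Q0 by (simp add: e_0 G_def q_0 e_eq \<phi>_0 algebra_simps)
  also have "(\<Sum>z\<in>UNIV. G z * E (x - z) * \<psi> (0 - z)) = - (\<Sum>z\<in>UNIV. G z * \<psi> z * E (x - z))"
    by (simp add: \<psi>_minus sum_negf mult_ac)
  finally show ?thesis using s_nz by simp
qed

text \<open>Fourier transform of \<open>\<psi>_relation\<close> at \<open>- v\<close>. It makes the
  two sums that are not multiples of \<open>\<phi> u\<close> cancel in the partial trace.\<close>

lemma \<phi>_relation:
  "\<gamma> * (\<Sum>u\<in>UNIV. \<phi> u * G (v - u)) = - s * G v * (\<Sum>u\<in>UNIV. \<phi> u * E (u - v))"
proof -
  have "FT (\<lambda>x. s * (E x * \<psi> x)) (- v) = FT (\<lambda>x. (-1) * (\<Sum>z\<in>UNIV. G z * \<psi> z * E (x - z))) (- v)"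
    by (simp add: \<psi>_relation)
  then have "s * (\<Sum>u\<in>UNIV. \<phi> u * FT E (- v + u)) = - ((\<Sum>u\<in>UNIV. \<phi> u * FT G (- v + u)) * FT E (- v))"
    unfolding FT_cmult FT_conv[of "\<lambda>z. G z * \<psi> z" E] unfolding \<psi>_def FT_mult by simp
  moreover have "FT E (- v + u) = \<gamma> * G (v - u)" for u
    using q_minus[of "v - u"] by (simp add: FT_E G_def)
  moreover have "FT E (- v) = \<gamma> * G v" by (simp add: FT_E G_def q_minus)
  ultimately have "s * (\<Sum>u\<in>UNIV. \<phi> u * (\<gamma> * G (v - u))) =
      - ((\<Sum>u\<in>UNIV. \<phi> u * (N / \<gamma> * E (u - v))) * (\<gamma> * G v))"
    by (simp add: FT_G)
  also have "\<dots> = - (N * G v * (\<Sum>u\<in>UNIV. \<phi> u * E (u - v)))"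
    using \<gamma>_nz by (simp add: sum_distrib_left sum_distrib_right mult_ac)
  also have "\<dots> = s * (- s * G v * (\<Sum>u\<in>UNIV. \<phi> u * E (u - v)))"
    by (simp flip: ss)
  finally have "s * (\<gamma> * (\<Sum>u\<in>UNIV. \<phi> u * G (v - u))) = s * (- s * G v * (\<Sum>u\<in>UNIV. \<phi> u * E (u - v)))"
    by (simp add: sum_distrib_left mult_ac)
  then show ?thesis by (rule mult_left_cancel[THEN iffD1, OF s_nz])
qed

section \<open>The partial trace\<close>

lemma G_E_inv: "G (u - x) * E (x - u) = 1 + (if x = u then s * E 0 else 0)"
  using E_inv[of "u - x"] by (auto simp: G_def mult_ac)

text \<open>For \<open>y \<noteq> u\<close>, \<open>pentagon_FT\<close> expresses
  \<open>T u (y - u)\<close> through values of \<open>FT E\<close>, and \<open>G (u - y)\<close> is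
  inverse to \<open>E (y - u)\<close>. For \<open>y = u\<close>, \<open>T_eq\<close>
  applies.\<close>

lemma K_W:
  "K (u - y) * e y * (q u * T u (y - u)) =
     s * G u * (\<phi> y - s / \<gamma> * (\<phi> y * E (y - u))) + (if y = u then N * E 0 * G u * \<phi> u else 0)"
proof (cases "y = u")
  case True
  show ?thesis
  \<comment> \<open>The extra term \<open>N\<close> of \<open>T_eq\<close> occurs at
    \<open>u = 0\<close>, where \<open>e\<close> vanishes.\<close>
  proof (cases "u = 0")
    case True
    then show ?thesis using \<open>y = u\<close> by (simp add: e_0 \<phi>_0)
  next
    case False
    have "K (u - y) * e y * (q u * T u (y - u)) = (E 0 - s / \<gamma>) * (s * E 0) * G u * \<phi> u"
      using True False by (simp add: K_def G_def q_0 e_eq T_eq)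
    also have "\<dots> = (E 0 * E 0 - s / \<gamma> * E 0) * s * G u * \<phi> u"
      by (simp add: algebra_simps)
    finally show ?thesis using True by (simp add: E0_sq k_1 algebra_simps flip: ss)
  qed
next
  case False
  define p where "p = q (u - y) * E (u - y)"
  have p1: "p * E (y - u) = 1" using G_E_inv[of u y] False by (simp add: p_def G_def)
  have "E u * FT E y = 1 / s * FT E (y - u) * T u (y - u)"
    using pentagon_FT[of u "y - u"] False by simp
  moreover have "FT E (y - u) = \<gamma> * p"
    using q_minus[of "u - y"] by (simp add: FT_E p_def)
  ultimately have "p * T u (y - u) = s * (E u * q y * E (- y))"
    using \<gamma>_nz s_nz by (simp add: FT_E field_simps)
  then have "p * (e y * (q u * T u (y - u))) = s * G u * (E y * E (- y) * q y * \<phi> y)"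
    by (simp add: e_eq G_def algebra_simps)
  then have "p * (e y * (q u * T u (y - u))) = s * G u * \<phi> y"
    by (simp only: E_inv_\<phi>)
  then have 1: "e y * (q u * T u (y - u)) = s * G u * \<phi> y * E (y - u)"
    using p1 by (metis mult.commute mult.left_commute mult_1)
  have "K (u - y) * e y * (q u * T u (y - u)) = (p - s / \<gamma>) * (s * G u * \<phi> y * E (y - u))"
    unfolding mult.assoc 1[unfolded mult.assoc] by (simp add: K_def G_def p_def)
  also have "\<dots> = s * G u * (\<phi> y * (p * E (y - u)) - s / \<gamma> * (\<phi> y * E (y - u)))"
    by (simp add: algebra_simps)
  finally show ?thesis using p1 False by simp
qed

text \<open>After exchanging sums, the sum over \<open>x\<close> is a value of \<open>T\<close>,
  because \<open>q (u - x)\<close> expands to \<open>q u * q x / B u x\<close>.\<close>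

lemma sum_Q:
  "(\<Sum>x\<in>UNIV. G (u - x) * (E x * Q u x)) =
     N * E 0 * G u * \<phi> u - N / \<gamma> * G u * (\<Sum>y\<in>UNIV. \<phi> y * E (y - u))"
proof -
  have W: "(\<Sum>x\<in>UNIV. G (u - x) * E x * B x y) = q u * T u (y - u)" for y
    unfolding T_def sum_distrib_left
    by (rule sum.cong) (simp_all add: G_def q_diff B_diffl B_diffr B_comm)
  have "(\<Sum>x\<in>UNIV. G (u - x) * (E x * Q u x)) =
      (\<Sum>y\<in>UNIV. K (u - y) * e y * (\<Sum>x\<in>UNIV. G (u - x) * E x * B x y))"
    unfolding Q_def sum_distrib_left by (subst sum.swap) (simp add: mult_ac)
  also have "\<dots> = s * G u * ((\<Sum>y\<in>UNIV. \<phi> y) - s / \<gamma> * (\<Sum>y\<in>UNIV. \<phi> y * E (y - u))) + N * E 0 * G u * \<phi> u"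
    unfolding W K_W
    by (simp only: sum.distrib sum_subtractf sum_distrib_left[symmetric]) simp
  finally show ?thesis by (simp add: sum_\<phi> algebra_simps flip: ss)
qed

text \<open>\<open>K_pentagon_D\<close> is multiplied by \<open>G (u - x)\<close> and summed over
  \<open>x\<close>. Every resulting term is a multiple of \<open>\<phi> u\<close> except those in
  \<open>X\<close> and \<open>Y\<close>, which cancel by \<open>\<phi>_relation\<close>.\<close>

lemma \<phi>_eq_0: "\<phi> u = 0"
proof -
  define X where "X = (\<Sum>y\<in>UNIV. \<phi> y * E (y - u))"
  define Y where "Y = (\<Sum>x\<in>UNIV. \<phi> x * G (u - x))"
  have "(\<Sum>x\<in>UNIV. G (u - x) * (\<phi> x * (s * (G u * E (x - u)) - s))) =
      (\<Sum>x\<in>UNIV. s * G u * \<phi> x + (if x = u then s * G u * (s * E 0) * \<phi> u else 0) - s * (\<phi> x * G (u - x)))"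
  proof (rule sum.cong)
    fix x
    have "G (u - x) * (\<phi> x * (s * (G u * E (x - u)) - s)) =
      s * G u * \<phi> x * (G (u - x) * E (x - u)) - s * (\<phi> x * G (u - x))"
      by (simp add: algebra_simps)
    also have "\<dots> = s * G u * \<phi> x + (if x = u then s * G u * (s * E 0) * \<phi> u else 0) - s * (\<phi> x * G (u - x))"
      unfolding G_E_inv by (simp add: algebra_simps)
    finally show "G (u - x) * (\<phi> x * (s * (G u * E (x - u)) - s)) = \<dots>" .
  qed simp
  also have "\<dots> = N * E 0 * G u * \<phi> u - s * Y"
    by (simp add: sum.distrib sum_subtractf sum_\<phi> Y_def flip: sum_distrib_left ss)
  finally have L: "(\<Sum>x\<in>UNIV. G (u - x) * (\<phi> x * (s * (G u * E (x - u)) - s))) =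
      N * E 0 * G u * \<phi> u - s * Y" .
  have "(\<Sum>x\<in>UNIV. G (u - x) * (s * (q u * (e u * E (x - u) + E u * e (x - u))))) =
      s * q u * e u * (\<Sum>x\<in>UNIV. G (u - x) * E (x - u)) + s * G u * (\<Sum>x\<in>UNIV. G (u - x) * e (x - u))"
    by (simp add: G_def sum.distrib sum_distrib_left algebra_simps)
  also have "(\<Sum>x\<in>UNIV. G (u - x) * e (x - u)) = 0"
    unfolding sum_reflect_conv G_conv_e by (simp add: \<psi>_0)
  also have "s * q u * e u * (\<Sum>x\<in>UNIV. G (u - x) * E (x - u)) + s * G u * 0 =
      s * G u * \<phi> u * (s * E 0 + N)"
    unfolding G_conv_E' by (simp add: e_eq G_def)
  finally have R1: "(\<Sum>x\<in>UNIV. G (u - x) * (s * (q u * (e u * E (x - u) + E u * e (x - u))))) =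
      s * G u * \<phi> u * (s * E 0 + N)" .
  have "(\<Sum>x\<in>UNIV. G (u - x) * (1 / s * (\<Sum>z\<in>UNIV. G z * E (x - z) * \<psi> (u - z)))) =
      1 / s * (\<Sum>z\<in>UNIV. G z * \<psi> (u - z) * (\<Sum>x\<in>UNIV. G (u - x) * E (x - z)))"
    unfolding sum_distrib_left by (subst sum.swap) (simp add: mult_ac)
  \<comment> \<open>The delta of \<open>G_conv_E'\<close> falls on \<open>z = u\<close>, where
    \<open>\<psi> 0 = 0\<close> removes it.\<close>
  also have "\<dots> = 1 / s * (\<Sum>z\<in>UNIV. s * E 0 * (G z * \<psi> (u - z)))"
  proof -
    have "G z * \<psi> (u - z) * (s * E 0 + (if u = z then N else 0)) = s * E 0 * (G z * \<psi> (u - z))" for z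
      by (cases "u = z") (simp_all add: \<psi>_0)
    then show ?thesis by (simp only: G_conv_E')
  qed
  also have "\<dots> = - E 0 * N * (G u * \<phi> u)"
    unfolding sum_distrib_left[symmetric] G_conv_\<psi> using s_nz by (simp add: e_eq G_def)
  finally have R2: "(\<Sum>x\<in>UNIV. G (u - x) * (1 / s * (\<Sum>z\<in>UNIV. G z * E (x - z) * \<psi> (u - z)))) =
      - E 0 * N * (G u * \<phi> u)" .
  have "(\<Sum>x\<in>UNIV. G (u - x) * (\<phi> x * (s * (G u * E (x - u)) - s) + E x * Q u x)) =
      (\<Sum>x\<in>UNIV. G (u - x) * (s * (q u * (e u * E (x - u) + E u * e (x - u))) +
        1 / s * (\<Sum>z\<in>UNIV. G z * E (x - z) * \<psi> (u - z))))"
    unfolding K_pentagon_D ..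
  then have "N * E 0 * G u * \<phi> u - s * Y + (N * E 0 * G u * \<phi> u - N / \<gamma> * G u * X) =
      s * G u * \<phi> u * (s * E 0 + N) + - E 0 * N * (G u * \<phi> u)"
    unfolding distrib_left[where a = "G (u - x)" for x] sum.distrib L R1 R2 sum_Q X_def .
  moreover have "s * Y = - (N / \<gamma> * G u * X)"
  proof -
    have "\<gamma> * (s * Y) = s * (\<gamma> * Y)" by simp
    also have "\<dots> = s * (- s * G u * X)" unfolding X_def Y_def \<phi>_relation ..
    finally have "\<gamma> * (s * Y) = - (N * G u * X)" by (simp flip: ss)
    then show ?thesis using \<gamma>_nz by (simp add: field_simps)
  qed
  \<comment> \<open>The two terms with \<open>E 0\<close> cancel on the right, so
    \<open>2 * E 0\<close> on the left faces \<open>s\<close>.\<close>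
  ultimately have "(2 * E 0 - s) * (N * G u * \<phi> u) = 0"
    by (simp add: algebra_simps flip: ss)
  then show ?thesis using two_E0[OF k_1] N_nz q_nz[of u] E_nz[of u] by (simp add: G_def)
qed

lemma D_E: "D (E u) = 0"
  using \<phi>_eq_0[of u] e_eq[of u] by (simp add: e_def)

end

section \<open>From rigidity to arbitrary solutions\<close>

context dilog
begin

lemma derivation_E_exceptional:
  assumes D: "derivation D" and k_1: "k = 1"
    and E: "\<And>x. x \<noteq> 0 \<Longrightarrow> E x = h"
  shows "D (E u) = 0"
proof (cases "u = 0")
  case True
  then show ?thesis using derivation_E0[OF D k_1] by simp
next
  case False
  then have "E u * E u * q u = 1"
    using inversion[of u] E[of u] E[of "- u"] by (simp add: k_1)
  then have "D (E u * E u * q u) = 0" by (simp add: derivation_1[OF D])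
  then have "2 * (E u * D (E u) * q u) = 0"
    by (simp add: derivation_mult[OF D] derivation_q[OF D] algebra_simps)
  then show ?thesis using E_nz q_nz by simp
qed

text \<open>In the exceptional case \<open>inversion\<close> makes \<open>E\<close>, and then
  \<open>q\<close>, constant off 0; so the group has at most four elements and the extra axiom
  supplies \<open>k = 1\<close>. On the trivial group \<open>E\<close> is vacuously constant off
  0.\<close>

lemma derivation_E:
  assumes D: "derivation D"
    and small: "card (UNIV :: 'a set) \<le> 4 \<Longrightarrow> (E 0)\<^sup>2 = s * E 0 + 1"
  shows "D (E u) = 0"
proof -
  have k_1: "k = 1" if "card (UNIV :: 'a set) \<le> 4"
    using small[OF that] E0_sq by (simp add: power2_eq_square)
  show ?thesis
  proof (cases "\<exists>a::'a. a \<noteq> 0")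
    case False
    then have U: "UNIV = {0::'a}" by auto
    have "card (UNIV :: 'a set) = 1" by (subst U) simp
    then show ?thesis
      using False by (intro derivation_E_exceptional[OF D k_1]) auto
  next
    case True
    then show ?thesis
    proof (cases rule: regular_or_exceptional)
      case (regular \<gamma>)
      then interpret regular_dilog q E C \<gamma> D
        using D by unfold_locales auto
      show ?thesis by (rule D_E)
    next
      case (exceptional \<gamma>)
      have E: "E x = \<gamma> * k / s" if x: "x \<noteq> 0" for x
      proof -
        have "E x * s = \<gamma> * (E x * E (- x) * q x)"
          unfolding exceptional(2)[OF x, symmetric] by simp
        also have "E x * E (- x) * q x = k" using x by (simp add: inversion)
        finally show ?thesis using s_nz by (simp add: nonzero_eq_divide_eq)
      qed
      have "q x = s / (\<gamma> * (\<gamma> * k / s))" if x: "x \<noteq> 0" for x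
        using exceptional(2)[OF x] E[of "- x"] x exceptional(1) k_nz s_nz
        by (simp add: field_simps)
      then have "card (UNIV :: 'a set) \<le> 4" by (rule card_le_4_of_constant)
      then show ?thesis using derivation_E_exceptional[OF D k_1 E] by blast
    qed
  qed
qed

end

theorem theorem8:
  fixes q :: "'a::{finite,ab_group_add} \<Rightarrow> complex"
    and E :: "'a \<Rightarrow> complex"
  assumes "metric_group q"
    and "finite_quantum_dilogarithm q E"
  shows "\<forall>u. algebraic (E u)"
proof (rule allI, rule ccontr)
  fix u
  assume "\<not> algebraic (E u)"
  then obtain D where D: "derivation D" "D (E u) = 1"
    using derivation_of_transcendental by blast
  interpret metric q by unfold_locales (rule assms(1))
  obtain C where C: "C \<noteq> 0"
      "\<And>x y. polar q x y * E x * E y =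
         C + 1 / s * (\<Sum>z\<in>UNIV. E (y - z) * E z * q z * E (x - z))"
    and small: "card (UNIV :: 'a set) \<le> 4 \<Longrightarrow> (E 0)\<^sup>2 = s * E 0 + 1"
    using assms(2) unfolding finite_quantum_dilogarithm_def Let_def s_def by blast
  interpret dilog q E C by unfold_locales (use C in auto)
  show False using derivation_E[OF D(1) small] D(2) by simp
qed

end
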